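(* Assume that $\mu\in\mathrm{Prob}(\mathbb{T}^d)$ satisfies a mixing Diophantine condition with parameters $\gamma,\tau>0$ and let $\alpha\in(0,1]$ with $\alpha>\tau$. Then for every nonzero $\varphi\in C^\alpha(\mathbb{T}^d)$ with $\int\varphi\,dm=0$ there exists $\sigma=\sigma(\varphi)>0$ such that $$\frac{S_n\varphi}{\sigma\sqrt n}\stackrel{d}{\longrightarrow}\mathcal{N}(0,1).$$ More precisely, for Lebesgue a.e. $\theta\in\mathbb{T}^d$ and for all $\lambda\in\mathbb{R}$, $$\lim_{n\to\infty}\mu^{\mathbb{N}}\left\{(\omega_i)_{i\ge0}\colon\frac{\varphi(\theta)+\varphi(\theta+\omega_0)+\cdots+\varphi(\theta+\omega_0+\cdots+\omega_{n-1})}{\sigma\sqrt n}\le\lambda\right\}=\int_{-\infty}^{\lambda}e^{-\frac{x^2}{2}}\,\frac{dx}{\sqrt{2\pi}}.$$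
   Context: $\mathbb{T}^d=\mathbb{R}^d/\mathbb{Z}^d$, $m$ is its Haar (Lebesgue) probability measure, $\mathrm{Prob}(\mathbb{T}^d)$ is the set of Borel probability measures on $\mathbb{T}^d$. The Fourier coefficients of $\mu$ are $\hat\mu(k)=\int_{\mathbb{T}^d}e^{2\pi i\langle k,\theta\rangle}\,d\mu(\theta)$, $k\in\mathbb{Z}^d$. $\mu$ satisfies a mixing Diophantine condition with parameters $\gamma,\tau>0$ if $|\hat\mu(k)|\le1-\frac{\gamma}{|k|^\tau}$ for all $k\in\mathbb{Z}^d\setminus\{0\}$, where $|\cdot|$ is a fixed norm on $\mathbb{Z}^d$ (e.g. the max norm). $C^\alpha(\mathbb{T}^d)$ is the space of $\alpha$-Hölder continuous functions $\varphi\colon\mathbb{T}^d\to\mathbb{R}$. $\mu^{\mathbb{N}}$ is the product measure on sequences $(\omega_i)_{i\ge0}\in(\mathbb{T}^d)^{\mathbb{N}}$. $S_n\varphi=\varphi(Z_0)+\cdots+\varphi(Z_{n-1})$, where $Z_0=\theta$ and $Z_j=\theta+\omega_0+\cdots+\omega_{j-1}$ for $j\ge1$, with $\theta$ distributed according to $m$ and $\omega_0,\omega_1,\dots$ i.i.d. with law $\mu$, independent of $\theta$. $\stackrel{d}{\longrightarrow}$ denotes convergence in distribution. *)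

theory Defs
  imports "HOL-Probability.Probability"
begin
definition int_lattice :: "(real ^ 'n) set"
  where "int_lattice = {x. \<forall>i. x $ i \<in> \<int>}"

lemma int_lattice_0: "0 \<in> int_lattice"
  and int_lattice_add: "x \<in> int_lattice \<Longrightarrow> y \<in> int_lattice \<Longrightarrow> x + y \<in> int_lattice"
  and int_lattice_uminus: "x \<in> int_lattice \<Longrightarrow> - x \<in> int_lattice"
  and int_lattice_diff: "x \<in> int_lattice \<Longrightarrow> y \<in> int_lattice \<Longrightarrow> x - y \<in> int_lattice"
  by (auto simp: int_lattice_def)

lemma closed_int_lattice: "closed (int_lattice :: (real ^ 'n) set)"
proof -
  have "closed {x :: real ^ 'n. \<forall>i. x $ i \<in> \<int>}"
    by (intro closed_Collect_all closed_vimage[OF closed_Ints, unfolded vimage_def] continuous_intros)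
  then show ?thesis by (simp add: int_lattice_def)
qed

definition torus_rel :: "real ^ 'n \<Rightarrow> real ^ 'n \<Rightarrow> bool"
  where "torus_rel x y \<longleftrightarrow> x - y \<in> int_lattice"

quotient_type (overloaded) 'n torus = "real ^ 'n" / "torus_rel"
  morphisms rep_torus abs_torus
proof (rule equivpI)
  show "reflp (torus_rel :: real ^ 'n \<Rightarrow> _)"
    by (simp add: reflp_def torus_rel_def int_lattice_0)
  show "symp (torus_rel :: real ^ 'n \<Rightarrow> _)"
    unfolding symp_def torus_rel_def by (metis int_lattice_uminus minus_diff_eq)
  show "transp (torus_rel :: real ^ 'n \<Rightarrow> _)"
    unfolding transp_def torus_rel_def by (metis int_lattice_add diff_add_cancel add_diff_eq)
qed

instantiation torus :: (finite) ab_group_add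
begin

lift_definition zero_torus :: "'a torus" is 0 .

lift_definition plus_torus :: "'a torus \<Rightarrow> 'a torus \<Rightarrow> 'a torus" is "(+)"
  unfolding torus_rel_def add_diff_add by (rule int_lattice_add)

lift_definition uminus_torus :: "'a torus \<Rightarrow> 'a torus" is uminus
  unfolding torus_rel_def minus_diff_minus by (rule int_lattice_uminus)

lift_definition minus_torus :: "'a torus \<Rightarrow> 'a torus \<Rightarrow> 'a torus" is "(-)"
proof -
  fix x x' y y' :: "real ^ 'a"
  assume "torus_rel x x'" "torus_rel y y'"
  then have "(x - x') - (y - y') \<in> int_lattice"
    unfolding torus_rel_def by (rule int_lattice_diff)
  then show "torus_rel (x - y) (x' - y')"
    by (simp add: torus_rel_def algebra_simps)
qed

instance
  by standard (transfer; simp add: torus_rel_def int_lattice_0 algebra_simps)+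

end

lemma infdist_lattice_cong:
  fixes x y :: "real ^ 'n"
  assumes "x - y \<in> int_lattice"
  shows "infdist x int_lattice = infdist y int_lattice"
proof -
  have *: "infdist u int_lattice \<le> infdist v int_lattice"
    if "u - v \<in> int_lattice" for u v :: "real ^ 'n"
  proof -
    obtain k where k: "k \<in> int_lattice" "infdist v int_lattice = dist v k"
      using infdist_attains_inf[OF closed_int_lattice] int_lattice_0 by blast
    have "dist u (k + (u - v)) = dist v k"
      by (simp add: dist_norm algebra_simps)
    then show ?thesis
      using infdist_le[OF int_lattice_add[OF k(1) that], of u] k(2) by simp
  qed
  have "y - x \<in> int_lattice"
    using int_lattice_uminus[OF assms] by simp
  with assms show ?thesis
    by (intro antisym *)
qed

text \<open>The flat metric: the distance of two classes is the minimal Euclidean distance of their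
  representatives.\<close>

instantiation torus :: (finite) metric_space
begin

lift_definition dist_torus :: "'a torus \<Rightarrow> 'a torus \<Rightarrow> real"
  is "\<lambda>x y. infdist (x - y) int_lattice"
proof -
  fix x x' y y' :: "real ^ 'a"
  assume "torus_rel x x'" "torus_rel y y'"
  then have "(x - x') - (y - y') \<in> int_lattice"
    by (auto simp: torus_rel_def intro: int_lattice_diff)
  then show "infdist (x - y) int_lattice = infdist (x' - y') int_lattice"
    by (intro infdist_lattice_cong) (simp add: algebra_simps)
qed

definition uniformity_torus :: "('a torus \<times> 'a torus) filter"
  where "uniformity_torus = (INF e\<in>{0 <..}. principal {(x, y). dist x y < e})"

definition open_torus :: "'a torus set \<Rightarrow> bool"
  where "open_torus U \<longleftrightarrow> (\<forall>x\<in>U. eventually (\<lambda>(x', y). x' = x \<longrightarrow> y \<in> U) uniformity)"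

instance
proof
  show "dist x y = 0 \<longleftrightarrow> x = y" for x y :: "'a torus"
  proof transfer
    fix x y :: "real ^ 'a"
    have "(int_lattice :: (real ^ 'a) set) \<noteq> {}"
      using int_lattice_0 by blast
    then show "infdist (x - y) int_lattice = 0 \<longleftrightarrow> torus_rel x y"
      using in_closed_iff_infdist_zero[OF closed_int_lattice] by (auto simp: torus_rel_def)
  qed
  show "dist x y \<le> dist x z + dist y z" for x y z :: "'a torus"
  proof transfer
    fix x y z :: "real ^ 'a"
    obtain k where k: "k \<in> int_lattice" "infdist (x - z) int_lattice = dist (x - z) k"
      using infdist_attains_inf[OF closed_int_lattice] int_lattice_0 by blast
    obtain l where l: "l \<in> int_lattice" "infdist (y - z) int_lattice = dist (y - z) l"
      using infdist_attains_inf[OF closed_int_lattice] int_lattice_0 by blast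
    have "infdist (x - y) int_lattice \<le> dist (x - y) (k - l)"
      by (intro infdist_le int_lattice_diff k l)
    also have "\<dots> = norm (((x - z) - k) - ((y - z) - l))"
      by (simp add: dist_norm algebra_simps)
    also have "\<dots> \<le> dist (x - z) k + dist (y - z) l"
      unfolding dist_norm by (rule norm_triangle_ineq4)
    finally show "infdist (x - y) int_lattice
        \<le> infdist (x - z) int_lattice + infdist (y - z) int_lattice"
      using k l by simp
  qed
qed (simp_all add: uniformity_torus_def open_torus_def)

end

lemma abs_torus_eq_iff: "abs_torus x = abs_torus y \<longleftrightarrow> x - y \<in> int_lattice"
  by (simp add: torus.abs_eq_iff torus_rel_def)

lemma dist_abs_torus_le: "dist (abs_torus x) (abs_torus y) \<le> dist x y"
  using infdist_le[OF int_lattice_0, of "x - y"] by (simp add: dist_torus.abs_eq dist_norm)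

lemma dist_abs_torus_attained:
  obtains y' where "abs_torus y' = abs_torus y" "dist (abs_torus x) (abs_torus y) = dist x y'"
proof -
  obtain k where k: "k \<in> int_lattice" "infdist (x - y) int_lattice = dist (x - y) k"
    using infdist_attains_inf[OF closed_int_lattice] int_lattice_0 by blast
  show thesis
  proof
    show "abs_torus (y + k) = abs_torus y"
      using k by (simp add: abs_torus_eq_iff)
    show "dist (abs_torus x) (abs_torus y) = dist x (y + k)"
      using k by (simp add: dist_torus.abs_eq dist_norm algebra_simps)
  qed
qed

lemma continuous_on_abs_torus: "continuous_on S abs_torus"
  unfolding continuous_on_iff by (meson dist_abs_torus_le le_less_trans)

lemma surj_abs_torus: "surj abs_torus"
  by (rule surjI) (rule Quotient3_abs_rep[OF Quotient3_torus])

text \<open>The metric topology is the quotient topology, so \<^term>\<open>borel\<close> on the torus is the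
  usual Borel \<open>\<sigma>\<close>-algebra of \<open>\<real>\<^sup>d/\<int>\<^sup>d\<close>.\<close>

lemma open_torus_iff: "open U \<longleftrightarrow> open (abs_torus -` U)"
proof
  show "open U \<Longrightarrow> open (abs_torus -` U)"
    by (rule open_vimage[OF _ continuous_on_abs_torus])
next
  assume U: "open (abs_torus -` U)"
  show "open U"
    unfolding open_dist
  proof
    fix p assume "p \<in> U"
    moreover obtain x where p: "p = abs_torus x"
      using surj_abs_torus by (metis surjD)
    ultimately have "x \<in> abs_torus -` U" by simp
    then obtain e where e: "e > 0" "\<And>y. dist y x < e \<Longrightarrow> y \<in> abs_torus -` U"
      using U unfolding open_dist by blast
    have "q \<in> U" if "dist q p < e" for q
    proof -
      obtain y where q: "q = abs_torus y"
        using surj_abs_torus by (metis surjD)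
      obtain y' where "abs_torus y' = abs_torus y" "dist (abs_torus x) (abs_torus y) = dist x y'"
        by (rule dist_abs_torus_attained)
      with that e(2)[of y'] show ?thesis
        by (simp add: p q dist_commute)
    qed
    with \<open>e > 0\<close> show "\<exists>e>0. \<forall>q. dist q p < e \<longrightarrow> q \<in> U" by blast
  qed
qed

definition unit_cube :: "(real ^ 'n) set"
  where "unit_cube = {x. \<forall>i. 0 \<le> x $ i \<and> x $ i < 1}"

text \<open>Haar measure as the push-forward of Lebesgue measure on a fundamental domain.\<close>

definition torus_haar :: "'n::finite torus measure"
  where "torus_haar = distr (restrict_space lborel unit_cube) borel abs_torus"

definition holder_continuous :: "real \<Rightarrow> ('a::metric_space \<Rightarrow> 'b::metric_space) \<Rightarrow> bool"
  where "holder_continuous \<alpha> f \<longleftrightarrow> (\<exists>C. \<forall>x y. dist (f x) (f y) \<le> C * dist x y powr \<alpha>)"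

definition real_vec :: "int ^ 'n \<Rightarrow> real ^ 'n"
  where "real_vec k = (\<chi> i. of_int (k $ i))"

lift_definition torus_char :: "int ^ 'n \<Rightarrow> 'n::finite torus \<Rightarrow> complex"
  is "\<lambda>k x. exp (2 * of_real pi * \<i> * of_real (real_vec k \<bullet> x))"
proof -
  fix k :: "int ^ 'n" and x y :: "real ^ 'n"
  assume "torus_rel x y"
  then have "real_vec k \<bullet> (x - y) \<in> \<int>"
    by (auto simp: torus_rel_def int_lattice_def inner_vec_def real_vec_def
        intro!: Ints_sum Ints_mult)
  then obtain j where "real_vec k \<bullet> (x - y) = of_int j"
    by (elim Ints_cases)
  then have "real_vec k \<bullet> x = real_vec k \<bullet> y + of_int j"
    by (simp add: inner_diff_right)
  then have "2 * of_real pi * \<i> * of_real (real_vec k \<bullet> x)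
      = 2 * of_real pi * \<i> * of_real (real_vec k \<bullet> y) + of_int (2 * j) * pi * \<i>"
    by (simp add: algebra_simps)
  then show "exp (2 * of_real pi * \<i> * of_real (real_vec k \<bullet> x))
      = exp (2 * of_real pi * \<i> * of_real (real_vec k \<bullet> y))"
    unfolding exp_eq by (rule exI)
qed

definition fourier_coeff :: "'n::finite torus measure \<Rightarrow> int ^ 'n \<Rightarrow> complex"
  where "fourier_coeff \<mu> k = (\<integral>\<theta>. torus_char k \<theta> \<partial>\<mu>)"

definition is_norm :: "('a::real_vector \<Rightarrow> real) \<Rightarrow> bool"
  where "is_norm N \<longleftrightarrow>
    (\<forall>x. N x = 0 \<longleftrightarrow> x = 0) \<and>
    (\<forall>c x. N (c *\<^sub>R x) = \<bar>c\<bar> * N x) \<and>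
    (\<forall>x y. N (x + y) \<le> N x + N y)"

text \<open>The size \<open>\<bar>k\<bar>\<close> of a frequency is measured by the restriction to \<open>\<int>\<^sup>d\<close> of a norm
  \<open>N\<close> on \<open>\<real>\<^sup>d\<close>, kept as a parameter.\<close>

definition mixing_DC ::
    "(real ^ 'n \<Rightarrow> real) \<Rightarrow> real \<Rightarrow> real \<Rightarrow> 'n::finite torus measure \<Rightarrow> bool"
  where "mixing_DC N \<gamma> \<tau> \<mu> \<longleftrightarrow>
    (\<forall>k. k \<noteq> 0 \<longrightarrow> cmod (fourier_coeff \<mu> k) \<le> 1 - \<gamma> / N (real_vec k) powr \<tau>)"

definition walk :: "'a::comm_monoid_add \<Rightarrow> (nat \<Rightarrow> 'a) \<Rightarrow> nat \<Rightarrow> 'a"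
  where "walk \<theta> \<omega> j = \<theta> + (\<Sum>i<j. \<omega> i)"

definition birkhoff_sum ::
    "('a::comm_monoid_add \<Rightarrow> real) \<Rightarrow> nat \<Rightarrow> 'a \<Rightarrow> (nat \<Rightarrow> 'a) \<Rightarrow> real"
  where "birkhoff_sum \<phi> n \<theta> \<omega> = (\<Sum>j<n. \<phi> (walk \<theta> \<omega> j))"

end

theory Submission
  imports Defs
begin

text \<open>
  Let \<open>P f(x) = \<integral> f(x + w) d\<mu>(w)\<close> be the transition operator of the walk. The characters \<open>e\<^sub>k\<close> are
  eigenfunctions of \<open>P\<close> with the Fourier coefficients of \<open>\<mu>\<close> as eigenvalues, so the Diophantine condition
  says that \<open>P\<^sup>n\<close> damps the frequency \<open>k\<close> by at least \<open>exp (- n c / \<bar>k\<bar>\<^sup>\<tau>)\<close>. A function with Hoelder exponent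
  \<open>\<alpha>\<close> is within \<open>O(m\<^sup>-\<^sup>\<alpha>)\<close> of a trigonometric polynomial of degree \<open>m\<close> in the uniform norm (a Jackson
  theorem, \<open>jackson_error\<close>). If \<open>m\<close> is a suitable power of \<open>n\<close>, then \<open>P\<^sup>n \<phi>\<close> decays uniformly like a
  power of \<open>n\<close>, with any exponent below \<open>\<alpha> / \<tau>\<close>. Because \<open>\<alpha> > \<tau>\<close>, the decay can be made summable
  (\<open>P_pow_summable_bound\<close>), and \<open>\<psi> = \<Sum>n. P\<^sup>n \<phi>\<close> is a continuous solution of the Poisson equation
  \<open>\<phi> = \<psi> - P \<psi>\<close> (\<open>poisson_equation\<close>). The same approximation shows that \<open>P\<^sup>n g\<close> converges uniformly to
  the mean of \<open>g\<close> for every continuous \<open>g\<close> (\<open>P_pow_uniform\<close>).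

  The variance is \<open>\<sigma>\<^sup>2 = \<integral> \<psi>\<^sup>2 - (P \<psi>)\<^sup>2\<close>, the variance of the martingale increment
  \<open>\<psi>(x + w) - P \<psi>(x)\<close>. If it vanished, \<open>P\<close> would act on \<open>\<psi>\<close> as a translation; the translates
  \<open>P\<^sup>n \<psi>\<close> converge uniformly to a constant, so \<open>\<psi>\<close> would be constant and \<open>\<phi> = 0\<close>
  (\<open>asymptotic_variance_pos\<close>).

  The characteristic function of the Birkhoff sum of length \<open>n\<close> started at \<open>x\<close> is the \<open>n\<close>-th iterate at
  the function \<open>1\<close> of the twisted operator \<open>g \<mapsto> exp (i s \<phi>) P g\<close>. Instead of a martingale limit theorem,
  the proof perturbs the eigenvalue \<open>1\<close> by hand: \<open>1 + i s \<psi> + s\<^sup>2 b\<close> is an eigenfunction for the eigenvalue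
  \<open>1 - s\<^sup>2 \<sigma>\<^sup>2 / 2\<close> up to a small multiple of \<open>s\<^sup>2\<close>, provided that the continuous function \<open>b\<close> solves
  \<open>b - P b = (\<sigma>\<^sup>2 - (\<psi>\<^sup>2 - (P \<psi>)\<^sup>2)) / 2\<close> up to a small error. Such a \<open>b\<close> exists by uniform
  convergence of the iterates (\<open>approx_corrector\<close>). With \<open>s = t / (\<sigma> \<surd>n)\<close> the \<open>n\<close>-th iterate tends to
  \<open>exp (- t\<^sup>2 / 2)\<close> (\<open>twisted_pow_tendsto\<close>), at every starting point and not only at almost every one. Levy's
  continuity theorem gives the quenched statement, and integration over the starting point the
  annealed one.
\<close>

section \<open>The torus as a compact topological group\<close>

lemma dist_torus_add_right [simp]: "dist (x + z) (y + z) = dist x (y :: 'n::finite torus)"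
  by transfer simp

lemma dist_torus_add_left [simp]: "dist (z + x) (z + y) = dist x (y :: 'n::finite torus)"
  by transfer simp

lemma dist_torus_minus_minus [simp]: "dist (- x) (- y) = dist x (y :: 'n::finite torus)"
proof -
  have "dist (- x) (- y) = dist y x"
    by transfer simp
  then show ?thesis by (simp add: dist_commute)
qed

lemma dist_torus_add_add_le: "dist (x + y) (x' + y') \<le> dist x x' + dist y (y' :: 'n::finite torus)"
  using dist_triangle[of "x + y" "x' + y'" "x' + y"] by simp

instance torus :: (finite) topological_ab_group_add
proof
  fix a b :: "'a torus"
  show "LIM x nhds a \<times>\<^sub>F nhds b. fst x + snd x :> nhds (a + b)"
    unfolding nhds_prod[symmetric]
  proof (rule tendstoI)
    fix e :: real assume "e > 0"
    have f: "((\<lambda>x. dist (fst x) a + dist (snd x) b) \<longlongrightarrow> dist a a + dist b b) (nhds (a, b))"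
      by (intro tendsto_intros) (auto simp: nhds_prod intro: filterlim_fst filterlim_snd)
    have "\<forall>\<^sub>F x in nhds (a, b). dist (fst x) a + dist (snd x) b < e"
      using order_tendstoD(2)[OF f] \<open>e > 0\<close> by simp
    then show "\<forall>\<^sub>F x in nhds (a, b). dist (fst x + snd x) (a + b) < e"
      by eventually_elim (metis dist_torus_add_add_le le_less_trans)
  qed
  show "(uminus \<longlongrightarrow> - a) (nhds a)"
  proof (rule tendstoI)
    fix e :: real assume "e > 0"
    then show "\<forall>\<^sub>F x in nhds a. dist (- x) (- a) < e"
      by (auto simp: eventually_nhds_metric)
  qed
qed

instance torus :: (finite) second_countable_topology
proof
  obtain D :: "(real ^ 'a) set" where D: "countable D" "\<And>X. open X \<Longrightarrow> X \<noteq> {} \<Longrightarrow> \<exists>d\<in>D. d \<in> X"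
    using countable_dense_setE by metis
  define \<B> where "\<B> = (\<lambda>(q, r). ball (abs_torus q) (of_rat r)) ` (D \<times> UNIV)"
  have op: "\<And>B. B \<in> \<B> \<Longrightarrow> open B" by (auto simp: \<B>_def)
  have "topological_basis \<B>"
  proof (rule topological_basisI[OF op])
    fix U :: "'a torus set" and x assume "open U" "x \<in> U"
    then obtain e where e: "e > 0" "ball x e \<subseteq> U"
      using open_contains_ball by blast
    obtain r where r: "0 < real_of_rat r" "real_of_rat r < e / 2"
      using of_rat_dense[of 0 "e / 2"] e by auto
    obtain y where x: "x = abs_torus y" using surj_abs_torus by (metis surjD)
    obtain q where q: "q \<in> D" "q \<in> ball y (of_rat r)"
      using D(2)[of "ball y (of_rat r)"] r by force
    have d: "dist x (abs_torus q) < of_rat r"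
      using q dist_abs_torus_le[of y q] x by (auto simp: dist_commute)
    have "ball (abs_torus q) (of_rat r) \<subseteq> ball x e"
    proof
      fix z assume "z \<in> ball (abs_torus q) (of_rat r)"
      then show "z \<in> ball x e"
        using d r dist_triangle[of x z "abs_torus q"] by simp
    qed
    then show "\<exists>B\<in>\<B>. x \<in> B \<and> B \<subseteq> U"
      using q d e by (intro bexI[of _ "ball (abs_torus q) (of_rat r)"]) (auto simp: \<B>_def dist_commute)
  qed
  moreover have "countable \<B>" using D(1) by (auto simp: \<B>_def)
  ultimately show "\<exists>B::'a torus set set. countable B \<and> open = generate_topology B"
    using topological_basis_imp_subbasis by blast
qed

section \<open>Translation invariance of the Haar measure\<close>

lemma ex1_real_vec_cube: "\<exists>!k. y - real_vec k \<in> (unit_cube :: (real ^ 'n) set)"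
proof (rule ex1I)
  show "y - real_vec (\<chi> i. \<lfloor>y $ i\<rfloor>) \<in> unit_cube"
    unfolding unit_cube_def real_vec_def by (auto; linarith)
  show "k = (\<chi> i. \<lfloor>y $ i\<rfloor>)" if "y - real_vec k \<in> unit_cube" for k
  proof (rule vec_eq_iff[THEN iffD2], rule allI)
    fix i
    have "0 \<le> y $ i - of_int (k $ i) \<and> y $ i - of_int (k $ i) < 1"
      using that by (auto simp: unit_cube_def real_vec_def)
    then show "k $ i = (\<chi> i. \<lfloor>y $ i\<rfloor>) $ i" by simp linarith
  qed
qed

lemma abs_torus_add_real_vec [simp]: "abs_torus (x + real_vec k) = abs_torus x"
  by (simp add: abs_torus_eq_iff int_lattice_def real_vec_def)

lemma abs_torus_in_cube: obtains y where "y \<in> unit_cube" "x = abs_torus y"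
proof -
  obtain z where z: "x = abs_torus z" using surj_abs_torus by (metis surjD)
  obtain k where "z - real_vec k \<in> unit_cube" using ex1_real_vec_cube by blast
  moreover have "x = abs_torus (z - real_vec k)"
    using abs_torus_add_real_vec[of "z - real_vec k" k] z by simp
  ultimately show thesis using that by blast
qed

lemma compact_UNIV_torus: "compact (UNIV :: 'n::finite torus set)"
proof -
  have "UNIV = abs_torus ` cbox (0 :: real ^ 'n) 1"
  proof -
    have "x \<in> abs_torus ` cbox (0 :: real ^ 'n) 1" for x :: "'n torus"
    proof -
      obtain y where "y \<in> unit_cube" "x = abs_torus y" by (rule abs_torus_in_cube)
      then show ?thesis by (auto simp: unit_cube_def mem_box_cart less_imp_le)
    qed
    then show ?thesis by auto
  qed
  then show ?thesis
    using compact_continuous_image[OF continuous_on_abs_torus compact_cbox] by metis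
qed

lemma measurable_abs_torus [measurable]: "abs_torus \<in> borel \<rightarrow>\<^sub>M borel"
  by (intro borel_measurable_continuous_onI continuous_on_abs_torus)

lemma unit_cube_measurable [measurable]: "unit_cube \<in> sets borel"
  unfolding unit_cube_def by measurable

lemma emeasure_unit_cube: "emeasure lborel (unit_cube :: (real ^ 'n) set) = 1"
proof -
  have 1: "box (0 :: real ^ 'n) 1 \<subseteq> unit_cube" "unit_cube \<subseteq> cbox (0 :: real ^ 'n) 1"
    by (auto simp: unit_cube_def mem_box_cart less_imp_le)
  have "1 \<bullet> b = 1" if "b \<in> Basis" for b :: "real ^ 'n"
    using that by (auto simp: Basis_vec_def inner_axis)
  then have "emeasure lborel (box (0 :: real ^ 'n) 1) = 1" "emeasure lborel (cbox (0 :: real ^ 'n) 1) = 1"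
    by (auto simp: emeasure_lborel_box_eq emeasure_lborel_cbox_eq)
  then show ?thesis
    using emeasure_mono[OF 1(1), of lborel] emeasure_mono[OF 1(2), of lborel] by (auto intro: antisym)
qed

lemma emeasure_lborel_vimage_add:
  assumes "A \<in> sets borel"
  shows "emeasure lborel {x. x + v \<in> A} = emeasure lborel (A :: 'a::euclidean_space set)"
proof -
  have "emeasure lborel A = emeasure (distr lborel borel ((+) v)) A"
    by (simp add: lborel_distr_plus)
  also have "\<dots> = emeasure lborel {x. x + v \<in> A}"
    using assms by (subst emeasure_distr) (auto simp: vimage_def add.commute)
  finally show ?thesis by simp
qed

text \<open>Only countably many translates of the fundamental cube are needed to cover the space, so a
  Borel set is the countable disjoint union of its pieces in the cubes of any shifted tiling.\<close>
lemma emeasure_cube_tiling: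
  fixes B :: "(real ^ 'n) set"
  assumes [measurable]: "B \<in> sets borel"
  shows "emeasure lborel B = (\<integral>\<^sup>+k. emeasure lborel (B \<inter> {x. x - w - real_vec k \<in> unit_cube}) \<partial>count_space UNIV)"
proof -
  have [measurable]: "{x. x - w - real_vec k \<in> unit_cube} \<in> sets (borel :: (real ^ 'n) measure)" for k
    by measurable
  have "B = (\<Union>k. B \<inter> {x. x - w - real_vec k \<in> unit_cube})"
    using ex1_real_vec_cube by blast
  then have "emeasure lborel B = emeasure lborel (\<Union>k. B \<inter> {x. x - w - real_vec k \<in> unit_cube})"
    by simp
  also have "\<dots> = (\<integral>\<^sup>+k. emeasure lborel (B \<inter> {x. x - w - real_vec k \<in> unit_cube}) \<partial>count_space UNIV)"
  proof (rule emeasure_UN_countable)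
    show "disjoint_family (\<lambda>k. B \<inter> {x. x - w - real_vec k \<in> unit_cube})"
      using ex1_real_vec_cube by (fastforce simp: disjoint_family_on_def)
  qed auto
  finally show ?thesis .
qed

text \<open>A shifted cube is again a fundamental domain: cut it along the integer tiling, move each piece
  back into the unit cube, which does not change a periodic set, and observe that the pieces are
  now the cells of the tiling by shifted cubes.\<close>
lemma emeasure_periodic_translate:
  fixes E :: "(real ^ 'n) set"
  assumes [measurable]: "E \<in> sets borel" and per: "\<And>x k. x + real_vec k \<in> E \<longleftrightarrow> x \<in> E"
  shows "emeasure lborel ({x. x + v \<in> E} \<inter> unit_cube) = emeasure lborel (E \<inter> unit_cube)"
proof -
  define F where "F = {y. y \<in> E \<and> y - v \<in> unit_cube}"
  have [measurable]: "F \<in> sets borel" unfolding F_def by measurable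
  have "emeasure lborel ({x. x + v \<in> E} \<inter> unit_cube) = emeasure lborel {x. x + v \<in> F}"
    by (simp add: F_def Collect_conj_eq)
  also have "\<dots> = emeasure lborel F" by (rule emeasure_lborel_vimage_add) measurable
  also have "\<dots> = (\<integral>\<^sup>+k. emeasure lborel (F \<inter> {x. x - 0 - real_vec k \<in> unit_cube}) \<partial>count_space UNIV)"
    by (rule emeasure_cube_tiling) measurable
  also have "\<dots> = (\<integral>\<^sup>+k. emeasure lborel {x. x + - real_vec k \<in> (E \<inter> unit_cube) \<inter> {x. x - v - - real_vec k \<in> unit_cube}} \<partial>count_space UNIV)"
  proof (rule nn_integral_cong, rule arg_cong[where f = "emeasure lborel"])
    fix k
    show "F \<inter> {x. x - 0 - real_vec k \<in> unit_cube} = {x. x + - real_vec k \<in> (E \<inter> unit_cube) \<inter> {x. x - v - - real_vec k \<in> unit_cube}}"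
      using per[of "_ - real_vec k" k] by (auto simp: F_def)
  qed
  also have "\<dots> = (\<integral>\<^sup>+k. emeasure lborel ((E \<inter> unit_cube) \<inter> {x. x - v - - real_vec k \<in> unit_cube}) \<partial>count_space UNIV)"
    by (intro nn_integral_cong emeasure_lborel_vimage_add) measurable
  also have "\<dots> = (\<integral>\<^sup>+k. emeasure lborel ((E \<inter> unit_cube) \<inter> {x. x - v - real_vec (- k) \<in> unit_cube}) \<partial>count_space UNIV)"
    by (intro nn_integral_cong) (simp add: real_vec_def vec_eq_iff uminus_vec_def)
  also have "\<dots> = (\<integral>\<^sup>+k. emeasure lborel ((E \<inter> unit_cube) \<inter> {x. x - v - real_vec k \<in> unit_cube}) \<partial>count_space UNIV)"
    using nn_integral_bij_count_space[of uminus UNIV UNIV "\<lambda>k. emeasure lborel ((E \<inter> unit_cube) \<inter> {x. x - v - real_vec k \<in> unit_cube})"]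
    by (simp add: bij_uminus)
  also have "\<dots> = emeasure lborel (E \<inter> unit_cube)"
    by (rule emeasure_cube_tiling[symmetric]) measurable
  finally show ?thesis .
qed

lemma sets_torus_haar [measurable_cong]: "sets torus_haar = sets borel"
  by (simp add: torus_haar_def)

lemma space_torus_haar [simp]: "space torus_haar = UNIV"
  by (simp add: torus_haar_def)

lemma emeasure_torus_haar:
  assumes [measurable]: "A \<in> sets borel"
  shows "emeasure torus_haar A = emeasure lborel ({x. abs_torus x \<in> A} \<inter> unit_cube)"
proof -
  have "emeasure torus_haar A = emeasure (restrict_space lborel unit_cube) (abs_torus -` A \<inter> unit_cube)"
    unfolding torus_haar_def
    by (subst emeasure_distr) (auto simp: space_restrict_space intro: measurable_restrict_space1)
  also have "\<dots> = emeasure lborel (abs_torus -` A \<inter> unit_cube)"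
    by (intro emeasure_restrict_space) auto
  finally show ?thesis by (simp add: vimage_def)
qed

interpretation torus_haar: prob_space "torus_haar :: 'n::finite torus measure"
  by standard (simp add: emeasure_torus_haar emeasure_unit_cube)

lemma distr_torus_haar_add:
  "distr torus_haar borel (\<lambda>x. x + s) = (torus_haar :: 'n::finite torus measure)"
proof (rule measure_eqI)
  fix A assume "A \<in> sets (distr torus_haar borel (\<lambda>x :: 'n torus. x + s))"
  then have [measurable]: "A \<in> sets borel" by simp
  obtain v where s: "s = abs_torus v" using surj_abs_torus by (metis surjD)
  have "emeasure (distr torus_haar borel (\<lambda>x. x + s)) A = emeasure torus_haar {x. x + s \<in> A}"
    by (subst emeasure_distr) (auto simp: vimage_def)
  also have "\<dots> = emeasure lborel ({x. x + v \<in> {x. abs_torus x \<in> A}} \<inter> unit_cube)"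
    by (subst emeasure_torus_haar) (auto simp: s plus_torus.abs_eq)
  also have "\<dots> = emeasure torus_haar A"
    by (subst emeasure_periodic_translate) (auto simp: emeasure_torus_haar)
  finally show "emeasure (distr torus_haar borel (\<lambda>x. x + s)) A = emeasure torus_haar A" .
qed (simp add: sets_torus_haar)

lemma integral_torus_haar_add:
  fixes f :: "'n::finite torus \<Rightarrow> 'b::{banach, second_countable_topology}"
  assumes [measurable]: "f \<in> borel_measurable borel"
  shows "(\<integral>x. f (x + s) \<partial>torus_haar) = (\<integral>x. f x \<partial>torus_haar)"
proof -
  have "(\<integral>x. f x \<partial>torus_haar) = (\<integral>x. f x \<partial>distr torus_haar borel (\<lambda>x. x + s))"
    by (simp add: distr_torus_haar_add)
  also have "\<dots> = (\<integral>x. f (x + s) \<partial>torus_haar)"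
    by (rule integral_distr) auto
  finally show ?thesis by simp
qed

section \<open>Characters and trigonometric polynomials\<close>

lemma real_vec_add: "real_vec (k + l) = real_vec k + real_vec l"
  and real_vec_diff: "real_vec (k - l) = real_vec k - real_vec l"
  and real_vec_minus: "real_vec (- k) = - real_vec k"
  and real_vec_0: "real_vec 0 = 0"
  by (simp_all add: real_vec_def vec_eq_iff)

lemma real_vec_axis: "real_vec (axis i 1) = axis i 1"
  by (auto simp: real_vec_def axis_def vec_eq_iff)

lemma real_vec_eq_0_iff: "real_vec k = 0 \<longleftrightarrow> k = 0"
  by (simp add: real_vec_def vec_eq_iff)

lemma torus_char_abs: "torus_char k (abs_torus x) = cis (2 * pi * (real_vec k \<bullet> x))"
  by (simp add: torus_char.abs_eq cis_conv_exp mult_ac)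

lemma torus_char_plus: "torus_char k (x + y) = torus_char k x * torus_char k y"
proof -
  obtain u v where "x = abs_torus u" "y = abs_torus v" using surj_abs_torus by (metis surjD)
  then show ?thesis
    by (simp add: plus_torus.abs_eq torus_char_abs cis_mult inner_add_right distrib_left)
qed

lemma torus_char_add_freq: "torus_char (k + l) x = torus_char k x * torus_char l x"
proof -
  obtain u where "x = abs_torus u" using surj_abs_torus by (metis surjD)
  then show ?thesis
    by (simp add: torus_char_abs cis_mult real_vec_add inner_add_left distrib_left)
qed

lemma torus_char_0_freq [simp]: "torus_char 0 x = 1"
proof -
  obtain u where "x = abs_torus u" using surj_abs_torus by (metis surjD)
  then show ?thesis by (simp add: torus_char_abs real_vec_0)
qed

lemma norm_torus_char [simp]: "cmod (torus_char k x) = 1"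
proof -
  obtain u where "x = abs_torus u" using surj_abs_torus by (metis surjD)
  then show ?thesis by (simp add: torus_char_abs)
qed

lemma torus_char_minus_freq: "torus_char (- k) x = cnj (torus_char k x)"
proof -
  obtain u where "x = abs_torus u" using surj_abs_torus by (metis surjD)
  then show ?thesis by (simp add: torus_char_abs real_vec_minus cis_cnj)
qed

lemma torus_char_uminus: "torus_char k (- x) = cnj (torus_char k x)"
proof -
  obtain u where "x = abs_torus u" using surj_abs_torus by (metis surjD)
  then show ?thesis by (simp add: torus_char_abs uminus_torus.abs_eq cis_cnj)
qed

lemma torus_char_diff_freq: "torus_char (k - l) x = torus_char k x * cnj (torus_char l x)"
  using torus_char_add_freq[of k "- l" x] by (simp add: torus_char_minus_freq)

lemma torus_char_diff: "torus_char k (x - y) = torus_char k x * cnj (torus_char k y)"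
  using torus_char_plus[of k x "- y"] by (simp add: torus_char_uminus)

text \<open>The topology of the torus is the quotient topology, so continuity can be tested on periodic
  lifts.\<close>
lemma continuous_on_torusI:
  fixes f :: "'n::finite torus \<Rightarrow> 'b::topological_space"
  assumes "continuous_on UNIV (\<lambda>x. f (abs_torus x))"
  shows "continuous_on UNIV f"
  unfolding continuous_on_open_vimage[OF open_UNIV]
proof (intro allI impI)
  fix B :: "'b set" assume "open B"
  then have "open ((\<lambda>x. f (abs_torus x)) -` B)"
    using assms by (auto simp: continuous_on_open_vimage[OF open_UNIV])
  then show "open (f -` B \<inter> UNIV)"
    by (simp add: open_torus_iff vimage_def)
qed

lemma continuous_on_torus_char: "continuous_on S (torus_char k)"
proof -
  have "continuous_on UNIV (torus_char k)"
    by (rule continuous_on_torusI) (auto simp: torus_char_abs cis_conv_exp intro!: continuous_intros)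
  then show ?thesis using continuous_on_subset by blast
qed

lemma measurable_torus_char [measurable]: "torus_char k \<in> borel_measurable borel"
  by (intro borel_measurable_continuous_onI continuous_on_torus_char)

text \<open>Invariance multiplies the integral of a nontrivial character by its value at any chosen point;
  at half a period of a coordinate with nonzero frequency that value is \<open>-1\<close>.\<close>
lemma integral_torus_char:
  "(\<integral>x. torus_char k x \<partial>torus_haar) = (if k = 0 then 1 else 0)"
proof (cases "k = 0")
  case True
  then show ?thesis by (simp add: torus_haar.prob_space[simplified])
next
  case False
  then obtain i where i: "k $ i \<noteq> 0" by (auto simp: vec_eq_iff)
  define s where "s = abs_torus (axis i (1 / (2 * of_int (k $ i)) :: real))"
  have s: "torus_char k s = -1"
    using i by (simp add: s_def torus_char_abs inner_axis real_vec_def)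
  have "(\<integral>x. torus_char k x \<partial>torus_haar) = (\<integral>x. torus_char k (x + s) \<partial>torus_haar)"
    by (rule integral_torus_haar_add[symmetric]) measurable
  then show ?thesis using False s by (simp add: torus_char_plus)
qed

text \<open>The chord \<open>\<bar>1 - exp(2 \<pi> i x)\<bar>\<close> equals \<open>2 \<bar>sin(\<pi> x)\<bar>\<close>, and \<open>sin y \<ge> y / 2\<close> on
  \<open>[0, \<pi>/2]\<close> by the cubic Taylor bound.\<close>
lemma sq_le_chord_sq:
  fixes x :: real
  assumes "\<bar>x\<bar> \<le> 1 / 2"
  shows "x\<^sup>2 \<le> (cmod (1 - cis (2 * pi * x)))\<^sup>2"
proof -
  define y where "y = \<bar>pi * x\<bar>"
  have y: "0 \<le> y" "y \<le> pi / 2"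
    using assms mult_left_mono[OF assms, of pi] by (auto simp: y_def abs_mult)
  have "\<bar>sin y - y\<bar> \<le> y ^ 3 / 6"
    using Maclaurin_sin_bound[of y 3] y
    by (simp add: sin_coeff_def eval_nat_numeral lessThan_Suc field_simps)
  moreover have "y ^ 3 / 6 \<le> y / 2"
  proof -
    have "y \<le> 16/10" using y pi_less_4 pi_approx by (simp)
    then have "y * y \<le> 16/10 * (16/10)" using y by (intro mult_mono) auto
    then have "y * (y * y) \<le> y * 3" using y by (intro mult_left_mono) auto
    then show ?thesis by (simp add: power3_eq_cube)
  qed
  ultimately have 1: "y / 2 \<le> \<bar>sin y\<bar>" by linarith
  have "\<bar>sin y\<bar> = \<bar>sin (pi * x)\<bar>" by (simp add: y_def abs_if)
  moreover have "\<bar>x\<bar> * 2 \<le> y"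
    using pi_ge_two mult_right_mono[of 2 pi "\<bar>x\<bar>"] by (simp add: y_def abs_mult mult_ac)
  ultimately have "\<bar>x\<bar> \<le> 2 * \<bar>sin (pi * x)\<bar>" using 1 by linarith
  moreover have "cmod (1 - cis (2 * pi * x)) = 2 * \<bar>sin (pi * x)\<bar>"
    using dist_exp_i_1[of "2 * pi * x"] by (simp add: cis_conv_exp norm_minus_commute)
  ultimately show ?thesis
    using power_mono[of "\<bar>x\<bar>" "2 * \<bar>sin (pi * x)\<bar>" 2] by simp
qed

text \<open>A trigonometric polynomial comparable to the squared distance to the origin. Its integral
  against the kernel below can be computed by Parseval.\<close>
definition char_modulus :: "'n::finite torus \<Rightarrow> real"
  where "char_modulus t = (\<Sum>i\<in>UNIV. (cmod (1 - torus_char (axis i 1) t))\<^sup>2)"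

lemma char_modulus_nonneg: "0 \<le> char_modulus t"
  by (simp add: char_modulus_def sum_nonneg)

lemma dist_sq_le_char_modulus: "(dist t 0)\<^sup>2 \<le> char_modulus (t :: 'n::finite torus)"
proof -
  obtain z where z: "t = abs_torus z" using surj_abs_torus by (metis surjD)
  define x where "x = (\<chi> i. z $ i - of_int (round (z $ i)))"
  have "z = x + real_vec (\<chi> i. round (z $ i))" by (simp add: x_def vec_eq_iff real_vec_def)
  then have x: "t = abs_torus x" using z by (metis abs_torus_add_real_vec)
  have xi: "\<bar>x $ i\<bar> \<le> 1 / 2" for i
    using of_int_round_abs_le[of "z $ i"] by (simp add: x_def abs_minus_commute)
  have "dist t 0 \<le> norm x"
    using dist_abs_torus_le[of x 0] by (simp add: x zero_torus.abs_eq[symmetric])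
  then have "(dist t 0)\<^sup>2 \<le> (norm x)\<^sup>2" by (simp add: power_mono)
  also have "\<dots> = (\<Sum>i\<in>UNIV. (x $ i)\<^sup>2)"
    by (simp add: norm_vec_def L2_set_def sum_nonneg)
  also have "\<dots> \<le> char_modulus t"
    unfolding char_modulus_def
    by (intro sum_mono) (use sq_le_chord_sq[OF xi] in \<open>simp add: x torus_char_abs real_vec_axis inner_axis' \<close>)
  finally show ?thesis .
qed

lemma integrable_torus_haar_bounded:
  fixes f :: "'n::finite torus \<Rightarrow> 'b::{banach, second_countable_topology}"
  assumes "f \<in> borel_measurable borel" "\<And>x. norm (f x) \<le> B"
  shows "integrable torus_haar f"
  using assms by (intro torus_haar.integrable_const_bound[of _ B]) auto

lemma integrable_torus_char [simp]: "integrable torus_haar (torus_char k)"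
  by (rule integrable_torus_haar_bounded[of _ 1]) auto

lemma trig_poly_abs_sq:
  "of_real ((cmod (\<Sum>k\<in>F. c k * torus_char k t))\<^sup>2)
    = (\<Sum>k\<in>F. \<Sum>l\<in>F. (c k * cnj (c l)) * torus_char (k - l) t)"
  unfolding complex_norm_square by (simp add: sum_product torus_char_diff_freq mult_ac)

text \<open>The finite Parseval identity, from the orthogonality of the characters. It turns the moments of the
  kernel below into sums over its coefficients.\<close>
lemma parseval_trig_poly:
  assumes "finite F"
  shows "(\<integral>t. (cmod (\<Sum>k\<in>F. c k * torus_char k t))\<^sup>2 \<partial>torus_haar) = (\<Sum>k\<in>F. (cmod (c k))\<^sup>2)"
proof -
  have "complex_of_real (\<integral>t. (cmod (\<Sum>k\<in>F. c k * torus_char k t))\<^sup>2 \<partial>torus_haar)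
      = (\<integral>t. (\<Sum>k\<in>F. \<Sum>l\<in>F. (c k * cnj (c l)) * torus_char (k - l) t) \<partial>torus_haar)"
    by (simp only: integral_complex_of_real[symmetric] trig_poly_abs_sq)
  also have "\<dots> = (\<Sum>k\<in>F. \<Sum>l\<in>F. (c k * cnj (c l)) * (if k = l then 1 else 0))"
    by (simp add: Bochner_Integration.integral_sum integral_torus_char)
  also have "\<dots> = of_real (\<Sum>k\<in>F. (cmod (c k))\<^sup>2)"
    using assms by (simp add: if_distrib complex_norm_square[symmetric] cong: if_cong)
  finally show ?thesis using of_real_eq_iff by blast
qed

section \<open>A Jackson kernel with tent-shaped amplitudes\<close>

text \<open>The kernel is \<open>\<bar>A\<bar>\<^sup>2 / \<integral>\<bar>A\<bar>\<^sup>2\<close>, where \<open>A\<close> has the coefficients \<open>tent m\<close>. Multiplication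
  of \<open>A\<close> by \<open>1 - e\<^sub>i\<close>, with \<open>e\<^sub>i\<close> the \<open>i\<close>-th basic character, takes differences of neighbouring
  coefficients. These differences are at most \<open>1\<close>, whereas a positive proportion of the coefficients
  is of size \<open>m\<close>. By Parseval the second moment of the kernel is therefore of order \<open>m\<^sup>-\<^sup>2\<close>, the
  best possible order for a nonnegative kernel of degree \<open>m\<close>.\<close>
definition freq_box :: "nat \<Rightarrow> (int ^ 'n::finite) set"
  where "freq_box m = {k. \<forall>i. \<bar>k $ i\<bar> \<le> int m}"

lemma freq_box_eq: "freq_box m = vec_lambda ` (UNIV \<rightarrow>\<^sub>E {- int m..int m})"
proof (intro set_eqI iffI)
  fix k :: "int ^ 'n" assume "k \<in> freq_box m"
  then have "vec_nth k \<in> UNIV \<rightarrow>\<^sub>E {- int m..int m}" by (auto simp: freq_box_def abs_le_iff minus_le_iff)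
  then show "k \<in> vec_lambda ` (UNIV \<rightarrow>\<^sub>E {- int m..int m})"
    by (intro image_eqI[of _ _ "vec_nth k"]) auto
qed (auto simp: freq_box_def PiE_iff abs_le_iff minus_le_iff)

lemma finite_freq_box [simp]: "finite (freq_box m)"
  by (simp add: freq_box_eq finite_PiE)

lemma freq_box_mono: "r \<le> m \<Longrightarrow> freq_box r \<subseteq> freq_box m"
  by (auto simp: freq_box_def intro: order_trans[of _ "int r"])

lemma card_freq_box: "card (freq_box m :: (int ^ 'n) set) = (2 * m + 1) ^ CARD('n)"
proof -
  have "inj_on (vec_lambda :: _ \<Rightarrow> int ^ 'n) (UNIV \<rightarrow>\<^sub>E {- int m..int m})"
    by (rule inj_on_inverseI[of _ vec_nth]) auto
  then show ?thesis by (simp add: freq_box_eq card_image card_PiE nat_add_distrib nat_mult_distrib)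
qed

definition tent :: "nat \<Rightarrow> int ^ 'n::finite \<Rightarrow> real"
  where "tent m k = max 0 (real m - norm (real_vec k))"

lemma tent_nonneg: "0 \<le> tent m k"
  by (simp add: tent_def)

lemma tent_nonzero_imp: "tent m k \<noteq> 0 \<Longrightarrow> norm (real_vec k) < real m"
  by (simp add: tent_def split: if_splits)

lemma tent_nonzero_imp_box: "tent m k \<noteq> 0 \<Longrightarrow> k \<in> freq_box m"
proof -
  assume "tent m k \<noteq> 0"
  then have "norm (real_vec k) < real m" by (rule tent_nonzero_imp)
  then have "\<bar>real_vec k $ i\<bar> < real m" for i
    using component_le_norm_cart[of "real_vec k" i] by simp
  then have "\<bar>k $ i\<bar> < int m" for i by (simp add: real_vec_def) (metis of_int_abs of_int_less_iff of_int_of_nat_eq)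
  then show "k \<in> freq_box m" by (simp add: freq_box_def less_imp_le)
qed

lemma tent_shift: "\<bar>tent m k - tent m (k - axis i 1)\<bar> \<le> 1"
proof -
  have "\<bar>norm (real_vec k) - norm (real_vec (k - axis i 1))\<bar> \<le> norm (real_vec k - real_vec (k - axis i 1))"
    by (rule norm_triangle_ineq3)
  also have "\<dots> = 1" by (simp add: real_vec_diff real_vec_axis norm_axis_1)
  finally show ?thesis by (auto simp: tent_def)
qed

text \<open>The tent is supported in the box of radius \<open>m\<close>; the sum runs over the next larger box so that
  it also contains the support shifted by a unit vector.\<close>
definition tent_poly :: "nat \<Rightarrow> 'n::finite torus \<Rightarrow> complex"
  where "tent_poly m t = (\<Sum>k\<in>freq_box (Suc m). of_real (tent m k) * torus_char k t)"

definition tent_mass :: "'n::finite itself \<Rightarrow> nat \<Rightarrow> real"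
  where "tent_mass _ m = (\<Sum>k\<in>freq_box (Suc m). (tent m (k :: int ^ 'n))\<^sup>2)"

lemma measurable_tent_poly [measurable]: "tent_poly m \<in> borel_measurable borel"
  unfolding tent_poly_def by measurable

text \<open>Summation by parts: a basic character shifts the coefficients by one.\<close>
lemma tent_poly_difference:
  "(1 - torus_char (axis i 1) t) * tent_poly m t
    = (\<Sum>k\<in>freq_box (Suc m). of_real (tent m k - tent m (k - axis i 1)) * torus_char k t)"
proof -
  let ?e = "axis i 1 :: int ^ 'a"
  have "torus_char ?e t * tent_poly m t
      = (\<Sum>k\<in>freq_box (Suc m). of_real (tent m k) * torus_char (k + ?e) t)"
    by (simp add: tent_poly_def sum_distrib_left torus_char_add_freq mult_ac)
  also have "\<dots> = (\<Sum>k\<in>freq_box m. of_real (tent m k) * torus_char (k + ?e) t)"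
  proof (rule sum.mono_neutral_right)
    show "\<forall>k\<in>freq_box (Suc m) - freq_box m. of_real (tent m k) * torus_char (k + ?e) t = 0"
      using tent_nonzero_imp_box[of m] by auto
    show "freq_box m \<subseteq> freq_box (Suc m)" by (simp add: freq_box_mono)
  qed simp
  also have "\<dots> = (\<Sum>k\<in>(\<lambda>k. k + ?e) ` freq_box m. of_real (tent m (k - ?e)) * torus_char k t)"
    by (subst sum.reindex) (auto simp: inj_on_def)
  also have "\<dots> = (\<Sum>k\<in>freq_box (Suc m). of_real (tent m (k - ?e)) * torus_char k t)"
  proof (rule sum.mono_neutral_left)
    show "(\<lambda>k. k + ?e) ` freq_box m \<subseteq> freq_box (Suc m)"
    proof (intro image_subsetI)
      fix k :: "int ^ 'a" assume "k \<in> freq_box m"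
      then have k: "\<bar>k $ j\<bar> \<le> int m" for j by (simp add: freq_box_def)
      have "\<bar>(k + ?e) $ j\<bar> \<le> int (Suc m)" for j
        using k[of j] by (cases "j = i") (auto simp: axis_def)
      then show "k + ?e \<in> freq_box (Suc m)" by (simp add: freq_box_def)
    qed
    show "\<forall>k\<in>freq_box (Suc m) - (\<lambda>k. k + ?e) ` freq_box m.
        of_real (tent m (k - ?e)) * torus_char k t = 0"
    proof
      fix k assume "k \<in> freq_box (Suc m) - (\<lambda>k. k + ?e) ` freq_box m"
      then have "k - ?e \<notin> freq_box m" by (force simp: image_iff)
      then have "tent m (k - ?e) = 0" using tent_nonzero_imp_box by blast
      then show "of_real (tent m (k - ?e)) * torus_char k t = 0" by simp
    qed
  qed simp
  finally show ?thesis
    by (simp add: left_diff_distrib tent_poly_def sum_subtractf)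
qed

lemma integral_tent_poly:
  "(\<integral>t. (cmod (tent_poly m t))\<^sup>2 \<partial>(torus_haar :: 'n::finite torus measure)) = tent_mass TYPE('n) m"
  unfolding tent_poly_def tent_mass_def by (subst parseval_trig_poly) auto

lemma integral_chord_tent_poly:
  "(\<integral>t. (cmod (1 - torus_char (axis i 1) t))\<^sup>2 * (cmod (tent_poly m t))\<^sup>2 \<partial>(torus_haar :: 'n::finite torus measure))
    \<le> real ((2 * m + 3) ^ CARD('n))"
proof -
  have "(\<integral>t. (cmod (1 - torus_char (axis i 1) t))\<^sup>2 * (cmod (tent_poly m t))\<^sup>2 \<partial>(torus_haar :: 'n::finite torus measure))
      = (\<Sum>k\<in>freq_box (Suc m). (cmod (of_real (tent m k - tent m (k - axis i 1 :: int ^ 'n))))\<^sup>2)"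
    unfolding power_mult_distrib[symmetric] norm_mult[symmetric] tent_poly_difference
    by (rule parseval_trig_poly) simp
  also have "\<dots> \<le> (\<Sum>k\<in>(freq_box (Suc m) :: (int ^ 'n) set). 1)"
    using tent_shift by (intro sum_mono) (simp add: abs_square_le_1 del: of_real_diff)
  also have "\<dots> = real ((2 * m + 3) ^ CARD('n))" by (simp add: card_freq_box eval_nat_numeral)
  finally show ?thesis .
qed

lemma norm_real_vec_le_box:
  assumes "k \<in> freq_box r" shows "norm (real_vec (k :: int ^ 'n)) \<le> real CARD('n) * real r"
proof -
  have "norm (real_vec k) \<le> (\<Sum>i\<in>UNIV. \<bar>real_vec k $ i\<bar>)" by (rule norm_le_l1_cart)
  also have "\<dots> \<le> (\<Sum>i\<in>(UNIV :: 'n set). real r)"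
  proof (rule sum_mono)
    fix i
    have "\<bar>k $ i\<bar> \<le> int r" using assms by (simp add: freq_box_def)
    then show "\<bar>real_vec k $ i\<bar> \<le> real r" by (simp add: real_vec_def)
  qed
  finally show ?thesis by simp
qed

text \<open>In dimension \<open>d\<close> the frequencies in the box of radius \<open>m / (2 d)\<close> have norm at most \<open>m / 2\<close>, so
  the tent is at least \<open>m / 2\<close> there.\<close>
lemma tent_mass_ge:
  assumes "m \<ge> 1"
  shows "(real m / (2 * real CARD('n))) ^ CARD('n) * (real m / 2)\<^sup>2 \<le> tent_mass TYPE('n::finite) m"
proof -
  let ?d = "CARD('n)"
  define r where "r = m div (2 * ?d)"
  have r1: "2 * ?d * r \<le> m" by (simp add: r_def)
  then have "real (2 * ?d * r) \<le> real m" by (simp only: of_nat_le_iff)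
  then have r2: "real ?d * real r \<le> real m / 2" by simp
  have "m < 2 * ?d * (r + 1)"
    using dividend_less_times_div[of "2 * ?d" m] by (simp add: r_def)
  then have "real m < real (2 * ?d * (r + 1))" by (simp only: of_nat_less_iff)
  then have "real m < 2 * real ?d * (real r + 1)" by (simp add: algebra_simps)
  also have "\<dots> \<le> 2 * real ?d * (2 * real r + 1)" by (intro mult_left_mono) auto
  finally have r3: "real m / (2 * real ?d) \<le> 2 * real r + 1"
    by (subst pos_divide_le_eq) (auto simp: mult_ac)
  have "(real m / (2 * real ?d)) ^ ?d * (real m / 2)\<^sup>2 \<le> (2 * real r + 1) ^ ?d * (real m / 2)\<^sup>2"
    using r3 by (intro mult_right_mono power_mono) auto
  also have "\<dots> = (\<Sum>k\<in>(freq_box r :: (int ^ 'n) set). (real m / 2)\<^sup>2)"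
    by (simp add: card_freq_box add.commute)
  also have "\<dots> \<le> (\<Sum>k\<in>(freq_box r :: (int ^ 'n) set). (tent m k)\<^sup>2)"
  proof (intro sum_mono power_mono)
    fix k :: "int ^ 'n" assume "k \<in> freq_box r"
    then have "norm (real_vec k) \<le> real m / 2" using norm_real_vec_le_box r2 order_trans by blast
    then show "real m / 2 \<le> tent m k" by (simp add: tent_def)
  qed simp
  also have "\<dots> \<le> tent_mass TYPE('n) m"
  proof -
    have "r \<le> Suc m" by (simp add: r_def le_SucI)
    then show ?thesis unfolding tent_mass_def
      by (intro sum_mono2 freq_box_mono) auto
  qed
  finally show ?thesis .
qed

lemma continuous_torus_bounded:
  fixes f :: "'n::finite torus \<Rightarrow> 'b::real_normed_vector"
  assumes "continuous_on UNIV f"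
  obtains B where "B \<ge> 0" "\<And>x. norm (f x) \<le> B"
proof -
  have "bounded (range f)"
    using compact_continuous_image[OF assms compact_UNIV_torus] by (rule compact_imp_bounded)
  then obtain B where B: "\<And>x. norm (f x) \<le> B" by (auto simp: bounded_iff)
  moreover have "B \<ge> 0" using norm_ge_zero[of "f undefined"] B[of undefined] by linarith
  ultimately show thesis using that by blast
qed

lemma integrable_torus_continuous:
  fixes f :: "'n::finite torus \<Rightarrow> 'b::{banach, second_countable_topology}"
  assumes "continuous_on UNIV f"
  shows "integrable torus_haar f"
proof -
  obtain B where "\<And>x. norm (f x) \<le> B" using continuous_torus_bounded[OF assms] by blast
  then show ?thesis
    using assms by (intro integrable_torus_haar_bounded[of f B] borel_measurable_continuous_onI)
qed

lemma continuous_on_translate: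
  fixes f :: "'a::topological_ab_group_add \<Rightarrow> 'b::topological_space"
  assumes "continuous_on UNIV f"
  shows "continuous_on UNIV (\<lambda>t. f (x + t))" "continuous_on UNIV (\<lambda>t. f (t + x))"
  by (rule continuous_on_compose2[OF assms]; auto intro!: continuous_intros)+

lemma continuous_on_tent_poly: "continuous_on S (tent_poly m)"
  unfolding tent_poly_def by (intro continuous_intros continuous_on_torus_char)

lemma continuous_on_char_modulus: "continuous_on S char_modulus"
  unfolding char_modulus_def by (intro continuous_intros continuous_on_torus_char)

text \<open>The constant that the crude counting below yields for the second moment of the kernel. It
  depends on the dimension alone.\<close>
definition jackson_const :: "'n::finite itself \<Rightarrow> real"
  where "jackson_const _ = 4 * real CARD('n) * (10 * real CARD('n)) ^ CARD('n)"

lemma jackson_const_nonneg: "0 \<le> jackson_const T"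
  by (simp add: jackson_const_def)

lemma tent_mass_pos: "m \<ge> 1 \<Longrightarrow> 0 < tent_mass TYPE('n::finite) m"
proof -
  assume m: "m \<ge> 1"
  then have "0 < (real m / (2 * real CARD('n))) ^ CARD('n) * (real m / 2)\<^sup>2" by simp
  then show ?thesis using tent_mass_ge[OF m, where 'n = 'n] by linarith
qed

lemma integral_char_modulus_tent_poly:
  assumes m: "m \<ge> 1"
  shows "(\<integral>t. char_modulus t * (cmod (tent_poly m t))\<^sup>2 \<partial>(torus_haar :: 'n::finite torus measure))
    \<le> jackson_const TYPE('n) / (real m)\<^sup>2 * tent_mass TYPE('n) m"
proof -
  let ?D = "CARD('n)" and ?M = "tent_mass TYPE('n) m"
  have "(\<integral>t. char_modulus t * (cmod (tent_poly m t))\<^sup>2 \<partial>(torus_haar :: 'n torus measure))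
      = (\<Sum>i\<in>UNIV. \<integral>t. (cmod (1 - torus_char (axis i 1) t))\<^sup>2 * (cmod (tent_poly m t))\<^sup>2 \<partial>(torus_haar :: 'n torus measure))"
    unfolding char_modulus_def sum_distrib_right
    by (intro Bochner_Integration.integral_sum integrable_torus_continuous continuous_intros
        continuous_on_torus_char continuous_on_tent_poly)
  also have "\<dots> \<le> (\<Sum>i\<in>(UNIV :: 'n set). real ((2 * m + 3) ^ ?D))"
    by (intro sum_mono integral_chord_tent_poly)
  also have "\<dots> = real ?D * (2 * real m + 3) ^ ?D" by simp
  also have "\<dots> \<le> real ?D * (5 * real m) ^ ?D"
    using m by (intro mult_left_mono power_mono) auto
  also have "(5 * real m) ^ ?D = (10 * real ?D) ^ ?D * (real m / (2 * real ?D)) ^ ?D"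
    by (subst power_mult_distrib[symmetric]) simp
  also have "real ?D * \<dots> = jackson_const TYPE('n) / (real m)\<^sup>2 * ((real m / (2 * real ?D)) ^ ?D * (real m / 2)\<^sup>2)"
  proof -
    have "real ?D * (Y * X) = 4 * real ?D * Y / (real m)\<^sup>2 * (X * (real m / 2)\<^sup>2)" for X Y
      using m by (simp add: power2_eq_square)
    then show ?thesis unfolding jackson_const_def .
  qed
  also have "\<dots> \<le> jackson_const TYPE('n) / (real m)\<^sup>2 * ?M"
    using tent_mass_ge[OF m, where 'n = 'n] jackson_const_nonneg[of "TYPE('n)"] by (intro mult_left_mono) auto
  finally show ?thesis .
qed

definition jackson :: "nat \<Rightarrow> ('n::finite torus \<Rightarrow> real) \<Rightarrow> 'n torus \<Rightarrow> real"
  where "jackson m f x = (\<integral>t. f (x + t) * (cmod (tent_poly m t))\<^sup>2 \<partial>torus_haar) / tent_mass TYPE('n) m"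

text \<open>The modulus of continuity of \<open>f\<close> enters as a bound \<open>a + b * char_modulus t\<close> on its increments.
  This form covers both a merely continuous \<open>f\<close> (small \<open>a\<close>, no control on \<open>b\<close>) and a Hoelder
  function (\<open>a\<close> and \<open>b / m\<^sup>2\<close> of order \<open>m powr - \<alpha>\<close>), and it integrates directly
  against the kernel.\<close>
lemma jackson_error:
  fixes f :: "'n::finite torus \<Rightarrow> real"
  assumes m: "m \<ge> 1" and f: "continuous_on UNIV f" and b: "b \<ge> 0"
    and mod: "\<And>x t. \<bar>f (x + t) - f x\<bar> \<le> a + b * char_modulus t"
  shows "\<bar>f x - jackson m f x\<bar> \<le> a + b * (jackson_const TYPE('n) / (real m)\<^sup>2)"
proof -
  let ?M = "tent_mass TYPE('n) m" and ?K = "\<lambda>t :: 'n torus. (cmod (tent_poly m t))\<^sup>2"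
  have M: "?M > 0" using tent_mass_pos[OF m] .
  have i1: "integrable torus_haar (\<lambda>t. f (x + t) * ?K t)" and i2: "integrable torus_haar (\<lambda>t. f x * ?K t)"
    and i3: "integrable torus_haar (\<lambda>t. a * ?K t + b * (char_modulus t * ?K t))"
    and i4: "integrable torus_haar (\<lambda>t. a * ?K t)" "integrable torus_haar (\<lambda>t. b * (char_modulus t * ?K t))"
    by (intro integrable_torus_continuous continuous_intros continuous_on_tent_poly continuous_on_char_modulus
        continuous_on_translate f)+
  have "f x * ?M = (\<integral>t. f x * ?K t \<partial>torus_haar)"
    by (simp add: integral_tent_poly)
  moreover have "jackson m f x * ?M = (\<integral>t. f (x + t) * ?K t \<partial>torus_haar)"
    using M by (simp add: jackson_def)
  ultimately have "(jackson m f x - f x) * ?M = (\<integral>t. f (x + t) * ?K t - f x * ?K t \<partial>torus_haar)"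
    by (simp only: Bochner_Integration.integral_diff[OF i1 i2] left_diff_distrib)
  also have "\<bar>\<dots>\<bar> \<le> (\<integral>t. a * ?K t + b * (char_modulus t * ?K t) \<partial>torus_haar)"
  proof (rule order_trans[OF integral_abs_bound], rule integral_mono)
    show "integrable torus_haar (\<lambda>t. \<bar>f (x + t) * ?K t - f x * ?K t\<bar>)"
      using i1 i2 by (intro integrable_abs Bochner_Integration.integrable_diff)
    show "\<bar>f (x + t) * ?K t - f x * ?K t\<bar> \<le> a * ?K t + b * (char_modulus t * ?K t)" for t
    proof -
      have "\<bar>f (x + t) * ?K t - f x * ?K t\<bar> = \<bar>f (x + t) - f x\<bar> * ?K t"
        unfolding left_diff_distrib[symmetric] abs_mult by simp
      also have "\<dots> \<le> (a + b * char_modulus t) * ?K t"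
        by (intro mult_right_mono mod) simp
      finally show ?thesis by (simp add: algebra_simps)
    qed
  qed (rule i3)
  also have "\<dots> = a * ?M + b * (\<integral>t. char_modulus t * ?K t \<partial>torus_haar)"
    by (subst Bochner_Integration.integral_add[OF i4]) (simp add: integral_tent_poly)
  also have "\<dots> \<le> a * ?M + b * (jackson_const TYPE('n) / (real m)\<^sup>2 * ?M)"
    using b integral_char_modulus_tent_poly[OF m] by (intro add_left_mono mult_left_mono) auto
  also have "\<dots> = (a + b * (jackson_const TYPE('n) / (real m)\<^sup>2)) * ?M" by (simp add: algebra_simps)
  finally have "\<bar>jackson m f x - f x\<bar> * ?M \<le> (a + b * (jackson_const TYPE('n) / (real m)\<^sup>2)) * ?M"
    using M by (simp add: abs_mult)
  then show ?thesis using M by (simp add: abs_minus_commute)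
qed

text \<open>Substituting \<open>s = x + t\<close> moves the kernel onto \<open>x\<close>, which exhibits the convolution as a
  trigonometric polynomial whose coefficients involve only the Fourier coefficients of \<open>f\<close>.\<close>
lemma jackson_eq_trig_poly:
  fixes f :: "'n::finite torus \<Rightarrow> real"
  assumes f: "continuous_on UNIV f"
  shows "complex_of_real (jackson m f x)
    = (\<Sum>(k, l)\<in>freq_box (Suc m) \<times> freq_box (Suc m).
        of_real (tent m k * tent m l / tent_mass TYPE('n) m)
          * (\<integral>s. of_real (f s) * torus_char (k - l) s \<partial>torus_haar) * torus_char (l - k) x)"
proof -
  let ?M = "tent_mass TYPE('n) m" and ?K = "\<lambda>t :: 'n torus. (cmod (tent_poly m t))\<^sup>2"
  have [measurable]: "f \<in> borel_measurable borel" using f by (rule borel_measurable_continuous_onI)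
  have [measurable]: "(\<lambda>s. s - x) \<in> borel_measurable borel"
    by (intro borel_measurable_continuous_onI continuous_intros)
  have e: "torus_char (k - l) (s - x) = torus_char (k - l) s * torus_char (l - k) x" for k l s
    using torus_char_minus_freq[of "k - l" x] by (simp add: torus_char_diff)
  have K: "complex_of_real (?K (s - x)) = (\<Sum>k\<in>freq_box (Suc m). \<Sum>l\<in>freq_box (Suc m).
      of_real (tent m k * tent m l) * (torus_char (k - l) s * torus_char (l - k) x))" for s
    unfolding tent_poly_def trig_poly_abs_sq
    by (simp add: e)
  have "(\<integral>t. f (x + t) * ?K t \<partial>torus_haar) = (\<integral>t. f (t + x) * ?K ((t + x) - x) \<partial>torus_haar)"
    by (simp add: add.commute)
  also have "\<dots> = (\<integral>s. f s * ?K (s - x) \<partial>torus_haar)"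
    by (rule integral_torus_haar_add[of "\<lambda>s. f s * ?K (s - x)"]) measurable
  finally have "complex_of_real (jackson m f x) = of_real (\<integral>s. f s * ?K (s - x) \<partial>torus_haar) / of_real ?M"
    by (simp add: jackson_def)
  also have "complex_of_real (\<integral>s. f s * ?K (s - x) \<partial>torus_haar)
      = (\<integral>s. (\<Sum>k\<in>freq_box (Suc m). \<Sum>l\<in>freq_box (Suc m).
          of_real (tent m k * tent m l) * (of_real (f s) * torus_char (k - l) s) * torus_char (l - k) x) \<partial>torus_haar)"
    unfolding integral_complex_of_real[symmetric] of_real_mult K
    by (simp add: sum_distrib_left mult_ac)
  also have "\<dots> = (\<Sum>k\<in>freq_box (Suc m). \<Sum>l\<in>freq_box (Suc m).
          of_real (tent m k * tent m l) * (\<integral>s. of_real (f s) * torus_char (k - l) s \<partial>torus_haar) * torus_char (l - k) x)"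
  proof -
    have "integrable torus_haar (\<lambda>s. complex_of_real (f s) * torus_char j s)" for j
      by (intro integrable_torus_continuous continuous_intros f continuous_on_torus_char)
    then show ?thesis by (simp add: Bochner_Integration.integral_sum)
  qed
  finally show ?thesis
    by (simp add: sum.cartesian_product[symmetric] sum_divide_distrib)
qed

section \<open>The averaging operator of the random walk\<close>

definition walk_avg :: "'a::plus measure \<Rightarrow> ('a \<Rightarrow> 'b::{banach, second_countable_topology}) \<Rightarrow> 'a \<Rightarrow> 'b"
  where "walk_avg \<mu> f x = (\<integral>w. f (x + w) \<partial>\<mu>)"

text \<open>The transition operator \<open>P\<close> is polymorphic, as it acts on real observables and on complex
  characters.\<close>
locale torus_walk = prob_space \<mu> for \<mu> :: "'n::finite torus measure" +
  assumes sets_mu [measurable_cong]: "sets \<mu> = sets borel"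
begin

abbreviation P :: "('n torus \<Rightarrow> 'b::{banach, second_countable_topology}) \<Rightarrow> 'n torus \<Rightarrow> 'b"
  where "P \<equiv> walk_avg \<mu>"

lemma space_mu [simp]: "space \<mu> = UNIV"
  using sets_eq_imp_space_eq[OF sets_mu] by simp

lemma prob_UNIV [simp]: "prob UNIV = 1"
  using prob_space by simp

lemma integrable_step:
  fixes f :: "'n torus \<Rightarrow> 'b::{banach, second_countable_topology}"
  assumes f: "continuous_on UNIV f"
  shows "integrable \<mu> (\<lambda>w. f (x + w))"
proof -
  obtain B where "\<And>x. norm (f x) \<le> B" using continuous_torus_bounded[OF f] by blast
  moreover have [measurable]: "f \<in> borel_measurable borel" using f by (rule borel_measurable_continuous_onI)
  ultimately show ?thesis by (intro integrable_const_bound[of _ B]) auto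
qed

lemma norm_P_le:
  fixes f :: "'n torus \<Rightarrow> 'b::{banach, second_countable_topology}"
  assumes "continuous_on UNIV f" "\<And>x. norm (f x) \<le> B"
  shows "norm (P f x) \<le> B"
proof -
  have "norm (P f x) \<le> (\<integral>w. norm (f (x + w)) \<partial>\<mu>)" unfolding walk_avg_def by (rule integral_norm_bound)
  also have "\<dots> \<le> (\<integral>w. B \<partial>\<mu>)"
    using assms by (intro integral_mono integrable_norm integrable_step) auto
  finally show ?thesis by (simp add: prob_space)
qed

lemma P_add: "continuous_on UNIV f \<Longrightarrow> continuous_on UNIV g \<Longrightarrow> P (\<lambda>x. f x + g x) x = P f x + P g x"
  unfolding walk_avg_def by (intro Bochner_Integration.integral_add integrable_step)

lemma P_diff: "continuous_on UNIV f \<Longrightarrow> continuous_on UNIV g \<Longrightarrow> P (\<lambda>x. f x - g x) x = P f x - P g x"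
  unfolding walk_avg_def by (intro Bochner_Integration.integral_diff integrable_step)

lemma P_sum: "(\<And>i. i \<in> I \<Longrightarrow> continuous_on UNIV (f i)) \<Longrightarrow> P (\<lambda>x. \<Sum>i\<in>I. f i x) x = (\<Sum>i\<in>I. P (f i) x)"
  unfolding walk_avg_def by (intro Bochner_Integration.integral_sum integrable_step)

lemma P_mult: "P (\<lambda>x. c * f x) x = c * P f x" for c :: "'b::{real_normed_field, banach, second_countable_topology}"
  unfolding walk_avg_def by simp

lemma P_const: "P (\<lambda>x. c) x = c"
  by (simp add: walk_avg_def prob_space)

lemma P_of_real: "P (\<lambda>x. complex_of_real (f x)) x = of_real (P f x)"
  by (simp add: walk_avg_def)

lemma continuous_P:
  fixes f :: "'n torus \<Rightarrow> 'b::{banach, second_countable_topology}"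
  assumes f: "continuous_on UNIV f"
  shows "continuous_on UNIV (P f)"
  unfolding continuous_on_iff
proof (intro ballI allI impI)
  fix x and e :: real assume "e > 0"
  have "uniformly_continuous_on UNIV f"
    using f compact_UNIV_torus by (rule compact_uniformly_continuous)
  then obtain d where d: "d > 0" "\<And>x y. dist y x < d \<Longrightarrow> dist (f y) (f x) < e / 2"
    using \<open>e > 0\<close> unfolding uniformly_continuous_on_def by (metis UNIV_I half_gt_zero)
  have "dist (P f y) (P f x) < e" if "dist y x < d" for y
  proof -
    have "dist (P f y) (P f x) = norm (\<integral>w. f (y + w) - f (x + w) \<partial>\<mu>)"
      using f by (simp add: dist_norm walk_avg_def integrable_step)
    also have "\<dots> \<le> (\<integral>w. norm (f (y + w) - f (x + w)) \<partial>\<mu>)" by (rule integral_norm_bound)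
    also have "\<dots> \<le> (\<integral>w. e / 2 \<partial>\<mu>)"
      using d(2)[of "y + w" "x + w" for w] that f
      by (intro integral_mono integrable_norm Bochner_Integration.integrable_diff integrable_step)
        (auto simp: dist_norm less_imp_le)
    finally show ?thesis using \<open>e > 0\<close> by (simp add: prob_space)
  qed
  with d(1) show "\<exists>d>0. \<forall>y\<in>UNIV. dist y x < d \<longrightarrow> dist (P f y) (P f x) < e" by blast
qed

lemma continuous_P_pow:
  fixes f :: "'n torus \<Rightarrow> 'b::{banach, second_countable_topology}"
  assumes "continuous_on UNIV f"
  shows "continuous_on UNIV ((P ^^ n) f)"
  by (induction n) (simp_all add: assms continuous_P)

lemma norm_P_pow_le:
  fixes f :: "'n torus \<Rightarrow> 'b::{banach, second_countable_topology}"
  assumes "continuous_on UNIV f" "\<And>x. norm (f x) \<le> B"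
  shows "norm ((P ^^ n) f x) \<le> B"
  by (induction n arbitrary: x) (simp_all add: assms norm_P_le continuous_P_pow)

lemma P_pow_diff:
  assumes "continuous_on UNIV f" "continuous_on UNIV g"
  shows "(P ^^ n) (\<lambda>x. f x - g x) = (\<lambda>x. (P ^^ n) f x - (P ^^ n) g x)"
  by (induction n) (auto simp: assms P_diff continuous_P_pow)

lemma P_pow_of_real: "(P ^^ n) (\<lambda>x. complex_of_real (f x)) = (\<lambda>x. of_real ((P ^^ n) f x))"
  by (induction n) (auto simp: P_of_real)

text \<open>The characters diagonalise \<open>P\<close>, with the Fourier coefficients of \<open>\<mu>\<close> as eigenvalues.\<close>
lemma P_torus_char: "P (torus_char k) x = fourier_coeff \<mu> k * torus_char k x"
  by (simp add: walk_avg_def fourier_coeff_def torus_char_plus mult.commute)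

lemma P_pow_trig_poly:
  "(P ^^ n) (\<lambda>x. \<Sum>j\<in>J. c j * torus_char (g j) x)
    = (\<lambda>x. \<Sum>j\<in>J. c j * fourier_coeff \<mu> (g j) ^ n * torus_char (g j) x)"
proof (induction n)
  case (Suc n)
  show ?case
    by (rule ext) (simp add: Suc P_sum continuous_intros continuous_on_torus_char P_mult P_torus_char, simp add: mult_ac)
qed simp

text \<open>The coefficients of \<open>jackson m f\<close> live on frequencies of norm below \<open>2 * m\<close>, and the zero
  frequency is absent because \<open>f\<close> has mean zero. Hence each of the remaining terms is damped by
  \<open>r\<close> at every step. The factor in front counts frequencies, by Cauchy-Schwarz applied to
  the tent.\<close>
lemma abs_P_pow_jackson_le:
  fixes f :: "'n torus \<Rightarrow> real"
  assumes m: "m \<ge> 1" and f: "continuous_on UNIV f" and f0: "(\<integral>x. f x \<partial>torus_haar) = 0"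
    and r: "r \<ge> 0" "\<And>k. k \<noteq> 0 \<Longrightarrow> norm (real_vec k) < 2 * real m \<Longrightarrow> cmod (fourier_coeff \<mu> k) \<le> r"
  shows "\<bar>(P ^^ n) (jackson m f) x\<bar> \<le> (2 * real m + 3) ^ CARD('n) * r ^ n * (\<integral>x. \<bar>f x\<bar> \<partial>torus_haar)"
proof -
  let ?M = "tent_mass TYPE('n) m" and ?B = "freq_box (Suc m) :: (int ^ 'n) set"
    and ?I = "\<integral>x. \<bar>f x\<bar> \<partial>torus_haar"
  have M: "?M > 0" using tent_mass_pos[OF m] .
  define c where "c j = (\<integral>s. complex_of_real (f s) * torus_char j s \<partial>torus_haar)" for j
  have c0: "c 0 = 0" using f0 by (simp add: c_def)
  have cI: "cmod (c j) \<le> ?I" for j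
    unfolding c_def by (rule order_trans[OF integral_norm_bound]) (simp add: norm_mult)
  have I0: "?I \<ge> 0" by simp
  have J: "(\<lambda>x. complex_of_real (jackson m f x)) = (\<lambda>x. \<Sum>p\<in>?B \<times> ?B.
      (of_real (tent m (fst p) * tent m (snd p) / ?M) * c (fst p - snd p)) * torus_char (snd p - fst p) x)"
    by (simp add: jackson_eq_trig_poly[OF f] c_def case_prod_beta)
  have "\<bar>(P ^^ n) (jackson m f) x\<bar> = cmod ((P ^^ n) (\<lambda>x. complex_of_real (jackson m f x)) x)"
    by (simp add: P_pow_of_real)
  also have "\<dots> \<le> (\<Sum>p\<in>?B \<times> ?B. cmod (of_real (tent m (fst p) * tent m (snd p) / ?M)
      * c (fst p - snd p) * fourier_coeff \<mu> (snd p - fst p) ^ n * torus_char (snd p - fst p) x))"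
    unfolding J P_pow_trig_poly by (rule norm_sum)
  also have "\<dots> \<le> (\<Sum>p\<in>?B \<times> ?B. tent m (fst p) * tent m (snd p) / ?M * (r ^ n * ?I))"
  proof (rule sum_mono)
    fix p assume "p \<in> ?B \<times> ?B"
    obtain k l where p: "p = (k, l)" by force
    have *: "cmod (c (k - l)) * cmod (fourier_coeff \<mu> (l - k)) ^ n \<le> r ^ n * ?I"
      if "tent m k \<noteq> 0" "tent m l \<noteq> 0"
    proof (cases "k = l")
      case True
      then show ?thesis using c0 r I0 by simp
    next
      case False
      have "norm (real_vec (l - k)) < 2 * real m"
        using norm_triangle_ineq4[of "real_vec l" "real_vec k"] tent_nonzero_imp[OF that(1)] tent_nonzero_imp[OF that(2)]
        by (simp add: real_vec_diff)
      then have "cmod (fourier_coeff \<mu> (l - k)) \<le> r" using False by (intro r(2)) auto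
      then have "cmod (c (k - l)) * cmod (fourier_coeff \<mu> (l - k)) ^ n \<le> ?I * r ^ n"
        using cI I0 by (intro mult_mono power_mono) auto
      then show ?thesis by (simp add: mult.commute)
    qed
    have t: "0 \<le> tent m k * tent m l / ?M" using M tent_nonneg[of m k] tent_nonneg[of m l] by simp
    have "tent m k * tent m l / ?M * (cmod (c (k - l)) * cmod (fourier_coeff \<mu> (l - k)) ^ n)
      \<le> tent m k * tent m l / ?M * (r ^ n * ?I)"
    proof (cases "tent m k = 0 \<or> tent m l = 0")
      case False
      then show ?thesis using * t by (intro mult_left_mono) auto
    qed auto
    then show "cmod (of_real (tent m (fst p) * tent m (snd p) / ?M)
      * c (fst p - snd p) * fourier_coeff \<mu> (snd p - fst p) ^ n * torus_char (snd p - fst p) x)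
      \<le> tent m (fst p) * tent m (snd p) / ?M * (r ^ n * ?I)"
      unfolding p fst_conv snd_conv norm_mult norm_power norm_torus_char norm_of_real abs_of_nonneg[OF t]
      by (simp only: mult.assoc mult_1_right)
  qed
  also have "\<dots> = (\<Sum>k\<in>?B. tent m k)\<^sup>2 / ?M * (r ^ n * ?I)"
  proof -
    have "(\<Sum>k\<in>?B. tent m k)\<^sup>2 = (\<Sum>p\<in>?B \<times> ?B. tent m (fst p) * tent m (snd p))"
      by (simp only: power2_eq_square sum_product sum.cartesian_product case_prod_unfold)
    then show ?thesis by (simp only: sum_divide_distrib sum_distrib_right)
  qed
  also have "\<dots> \<le> (?M * real (card ?B)) / ?M * (r ^ n * ?I)"
    using M r I0 sum_squared_le_sum_of_squares[of "tent m" ?B]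
    by (intro mult_right_mono divide_right_mono) (auto simp: tent_mass_def)
  also have "\<dots> = (2 * real m + 3) ^ CARD('n) * r ^ n * ?I"
    using M by (simp add: card_freq_box add.commute)
  finally show ?thesis .
qed

lemma continuous_jackson:
  assumes "continuous_on UNIV f"
  shows "continuous_on UNIV (jackson m f)"
proof -
  have "continuous_on UNIV (\<lambda>x. complex_of_real (jackson m f x))"
    unfolding jackson_eq_trig_poly[OF assms] case_prod_beta
    by (intro continuous_intros continuous_on_torus_char)
  then have "continuous_on UNIV (\<lambda>x. Re (complex_of_real (jackson m f x)))" by (rule continuous_on_Re)
  then show ?thesis by simp
qed

text \<open>Splitting \<open>f\<close> into its approximation error, on which \<open>P\<close> is a contraction, and the trigonometric
  polynomial \<open>jackson m f\<close>.\<close>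
lemma abs_P_pow_le:
  fixes f :: "'n torus \<Rightarrow> real"
  assumes m: "m \<ge> 1" and f: "continuous_on UNIV f" and f0: "(\<integral>x. f x \<partial>torus_haar) = 0"
    and b: "b \<ge> 0" and mod: "\<And>x t. \<bar>f (x + t) - f x\<bar> \<le> a + b * char_modulus t"
    and r: "r \<ge> 0" "\<And>k. k \<noteq> 0 \<Longrightarrow> norm (real_vec k) < 2 * real m \<Longrightarrow> cmod (fourier_coeff \<mu> k) \<le> r"
  shows "\<bar>(P ^^ n) f x\<bar> \<le> a + b * (jackson_const TYPE('n) / (real m)\<^sup>2)
      + (2 * real m + 3) ^ CARD('n) * r ^ n * (\<integral>x. \<bar>f x\<bar> \<partial>torus_haar)"
proof -
  have j: "continuous_on UNIV (jackson m f)" by (rule continuous_jackson[OF f])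
  have "norm ((P ^^ n) (\<lambda>x. f x - jackson m f x) x) \<le> a + b * (jackson_const TYPE('n) / (real m)\<^sup>2)"
    using jackson_error[OF m f b mod] by (intro norm_P_pow_le continuous_intros f j) auto
  then have "\<bar>(P ^^ n) f x - (P ^^ n) (jackson m f) x\<bar> \<le> a + b * (jackson_const TYPE('n) / (real m)\<^sup>2)"
    by (simp add: P_pow_diff[OF f j])
  moreover have "\<bar>(P ^^ n) (jackson m f) x\<bar> \<le> (2 * real m + 3) ^ CARD('n) * r ^ n * (\<integral>x. \<bar>f x\<bar> \<partial>torus_haar)"
    by (rule abs_P_pow_jackson_le[OF m f f0 r(1)]) (rule r(2))
  ultimately show ?thesis by linarith
qed

end

section \<open>Decay of the averages and the Poisson equation\<close>

lemma modulus_continuous: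
  fixes f :: "'n::finite torus \<Rightarrow> real"
  assumes f: "continuous_on UNIV f" and "e > 0"
  obtains b where "b \<ge> 0" "\<And>x t. \<bar>f (x + t) - f x\<bar> \<le> e + b * char_modulus t"
proof -
  obtain B where B: "B \<ge> 0" "\<And>x. norm (f x) \<le> B" using continuous_torus_bounded[OF f] by blast
  have "uniformly_continuous_on UNIV f"
    using f compact_UNIV_torus by (rule compact_uniformly_continuous)
  then obtain d where d: "d > 0" "\<And>x y. dist y x < d \<Longrightarrow> dist (f y) (f x) < e"
    using \<open>e > 0\<close> unfolding uniformly_continuous_on_def by (metis UNIV_I)
  show thesis
  proof (rule that)
    show "2 * B / d\<^sup>2 \<ge> 0" using B by simp
    show "\<bar>f (x + t) - f x\<bar> \<le> e + 2 * B / d\<^sup>2 * char_modulus t" for x t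
    proof (cases "dist t 0 < d")
      case True
      then have "dist (x + t) (x + 0) < d" by (simp only: dist_torus_add_left)
      then have "dist (f (x + t)) (f x) < e" by (intro d(2)) simp
      moreover have "0 \<le> 2 * B / d\<^sup>2 * char_modulus t" using B by (simp add: char_modulus_nonneg)
      ultimately show ?thesis by (simp add: dist_real_def)
    next
      case False
      then have "d\<^sup>2 \<le> (dist t 0)\<^sup>2" using d(1) by (intro power_mono) auto
      also have "\<dots> \<le> char_modulus t" by (rule dist_sq_le_char_modulus)
      finally have "1 \<le> char_modulus t / d\<^sup>2" using d(1) by simp
      then have "2 * B * 1 \<le> 2 * B * (char_modulus t / d\<^sup>2)" using B by (intro mult_left_mono) auto
      moreover have "\<bar>f (x + t) - f x\<bar> \<le> 2 * B" using B(2)[of x] B(2)[of "x + t"] by simp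
      ultimately show ?thesis using \<open>e > 0\<close> by simp
    qed
  qed
qed

text \<open>Interpolation at the scale \<open>1 / m\<close>: \<open>u powr \<alpha> \<le> 1 + u\<^sup>2\<close> for \<open>u = m * dist t 0\<close>.\<close>
lemma modulus_holder:
  fixes f :: "'n::finite torus \<Rightarrow> real"
  assumes H: "H \<ge> 0" "\<And>x y. dist (f x) (f y) \<le> H * dist x y powr \<alpha>"
    and \<alpha>: "0 < \<alpha>" "\<alpha> \<le> 1" and m: "m > 0"
  shows "\<bar>f (x + t) - f x\<bar> \<le> H * m powr - \<alpha> + H * m powr - \<alpha> * m\<^sup>2 * char_modulus t"
proof -
  let ?d = "dist t 0"
  have "dist (x + t) (x + 0) = ?d" by (simp only: dist_torus_add_left)
  then have "\<bar>f (x + t) - f x\<bar> \<le> H * ?d powr \<alpha>"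
    using H(2)[of "x + t" x] by (simp add: dist_real_def)
  also have "?d powr \<alpha> = m powr - \<alpha> * (m * ?d) powr \<alpha>"
    using m by (simp add: powr_mult powr_minus field_simps)
  also have "(m * ?d) powr \<alpha> \<le> 1 + (m * ?d)\<^sup>2"
  proof (cases "m * ?d \<le> 1")
    case True
    then have "(m * ?d) powr \<alpha> \<le> 1" using m \<alpha> by (intro powr_le1) auto
    then show ?thesis by (smt (verit) zero_le_power2)
  next
    case False
    then have "(m * ?d) powr \<alpha> \<le> (m * ?d) powr 2" using \<alpha> by (intro powr_mono) auto
    then show ?thesis using False by (simp add: powr_numeral)
  qed
  also have "1 + (m * ?d)\<^sup>2 \<le> 1 + m\<^sup>2 * char_modulus t"
    using dist_sq_le_char_modulus[of t] by (simp add: power_mult_distrib mult_left_mono)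
  finally have "\<bar>f (x + t) - f x\<bar> \<le> H * (m powr - \<alpha> * (1 + m\<^sup>2 * char_modulus t))"
    using H(1) by (simp add: mult_left_mono)
  then show ?thesis by (simp add: algebra_simps)
qed

lemma summable_powr_exp:
  fixes a c \<delta> :: real
  assumes "c > 0" "\<delta> > 0"
  shows "summable (\<lambda>n. real n powr a * exp (- (c * real n powr \<delta>)))"
proof -
  \<comment> \<open>For large \<open>p\<close> the bound \<open>exp (- y) \<le> (p / y) ^ p\<close> beats every power of \<open>n\<close>.\<close>
  obtain p :: nat where p: "real p > max 1 ((a + 2) / \<delta>)" using reals_Archimedean2 by blast
  then have p1: "real p > 1" and p2: "a + 2 < real p * \<delta>"
    using \<open>\<delta> > 0\<close> by (auto simp: pos_divide_less_eq)
  have p0: "real p > 0" using p1 by linarith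
  define K where "K = (real p / c) ^ p"
  have "norm (real n powr a * exp (- (c * real n powr \<delta>))) \<le> K * real n powr - 2" if n: "n \<ge> 1" for n
  proof -
    define y where "y = c * real n powr \<delta>"
    have y: "y > 0" using assms n by (simp add: y_def)
    have "y / real p \<le> exp (y / real p)"
      using exp_ge_add_one_self[of "y / real p"] by linarith
    then have "(y / real p) ^ p \<le> exp (y / real p) ^ p"
      using y p0 by (intro power_mono) auto
    also have "\<dots> = exp y" using p0 by (simp add: exp_of_nat_mult[symmetric])
    finally have "exp (- y) \<le> inverse ((y / real p) ^ p)"
      using y p0 by (simp add: exp_minus le_imp_inverse_le)
    also have "\<dots> = K * inverse ((real n powr \<delta>) ^ p)"
      by (simp add: K_def y_def power_mult_distrib power_divide divide_simps)
    also have "(real n powr \<delta>) ^ p = real n powr (real p * \<delta>)"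
      using n by (simp add: powr_powr powr_realpow[symmetric] mult.commute)
    finally have "real n powr a * exp (- y) \<le> real n powr a * (K * real n powr - (real p * \<delta>))"
      by (intro mult_left_mono) (auto simp: powr_minus)
    also have "\<dots> = K * real n powr (a - real p * \<delta>)"
      using n by (simp add: powr_diff powr_minus divide_inverse)
    also have "\<dots> \<le> K * real n powr - 2"
      using n p2 p0 \<open>c > 0\<close> by (intro mult_left_mono powr_mono) (auto simp: K_def)
    finally show ?thesis by (simp add: y_def)
  qed
  moreover have "summable (\<lambda>n. K * real n powr - 2)"
    by (intro summable_mult) (simp add: summable_real_powr_iff)
  ultimately show ?thesis
    by (rule summable_comparison_test'[rotated])
qed

lemma jackson_const_small:
  assumes "e > 0"
  obtains m where "m \<ge> 1" "b * (jackson_const T / (real m)\<^sup>2) < e"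
proof -
  have "(\<lambda>m. b * (jackson_const T / (real m)\<^sup>2)) \<longlonglongrightarrow> b * 0"
    by (intro tendsto_mult tendsto_const tendsto_divide_0[OF tendsto_const] filterlim_at_top_imp_at_infinity
        filterlim_pow_at_top filterlim_real_sequentially) auto
  then have "\<forall>\<^sub>F m in sequentially. b * (jackson_const T / (real m)\<^sup>2) < e"
    by (rule order_tendstoD) (use assms in simp)
  then show thesis
    using eventually_happens[OF eventually_conj[OF eventually_ge_at_top[of 1]]] that by fastforce
qed

text \<open>The mixing Diophantine condition in the form in which it is used, with the Euclidean norm in
  place of the given one and \<open>1 - u\<close> weakened to \<open>exp (- u)\<close>.\<close>
locale diophantine_walk = torus_walk \<mu> for \<mu> :: "'n::finite torus measure" +
  fixes c \<tau> :: real
  assumes c_pos: "c > 0" and tau_pos: "\<tau> > 0"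
    and decay: "\<And>k. k \<noteq> 0 \<Longrightarrow> cmod (fourier_coeff \<mu> k) \<le> exp (- (c / norm (real_vec k) powr \<tau>))"
begin

lemma decay_below:
  assumes "k \<noteq> 0" "norm (real_vec k) < 2 * real m"
  shows "cmod (fourier_coeff \<mu> k) \<le> exp (- (c / (2 * real m) powr \<tau>))"
proof -
  have pos: "norm (real_vec k) > 0" using assms(1) by (simp add: real_vec_eq_0_iff)
  then have "2 * real m > 0" using assms(2) by linarith
  with pos have "c / (2 * real m) powr \<tau> \<le> c / norm (real_vec k) powr \<tau>"
    using assms(2) c_pos tau_pos by (intro divide_left_mono powr_mono2) auto
  then show ?thesis using decay[OF assms(1)] by (simp add: order_trans)
qed

lemma abs_P_pow_le_decay:
  fixes f :: "'n torus \<Rightarrow> real"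
  assumes m: "m \<ge> 1" and f: "continuous_on UNIV f" and f0: "(\<integral>x. f x \<partial>torus_haar) = 0"
    and b: "b \<ge> 0" and mod: "\<And>x t. \<bar>f (x + t) - f x\<bar> \<le> a + b * char_modulus t"
  shows "\<bar>(P ^^ n) f x\<bar> \<le> a + b * (jackson_const TYPE('n) / (real m)\<^sup>2)
      + (2 * real m + 3) ^ CARD('n) * exp (- (c / (2 * real m) powr \<tau>)) ^ n * (\<integral>x. \<bar>f x\<bar> \<partial>torus_haar)"
  by (rule abs_P_pow_le[OF m f f0 b mod]) (auto intro: decay_below)

text \<open>Unique ergodicity with uniform convergence of the unaveraged iterates: first fix a degree \<open>m\<close>
  that makes the approximation error small, then let the remaining geometric term decay.\<close>
lemma P_pow_uniform_mean_zero:
  fixes f :: "'n torus \<Rightarrow> real"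
  assumes f: "continuous_on UNIV f" and f0: "(\<integral>x. f x \<partial>torus_haar) = 0"
  shows "uniform_limit UNIV (\<lambda>n. (P ^^ n) f) (\<lambda>_. 0) sequentially"
proof (rule uniform_limitI)
  fix e :: real assume e: "e > 0"
  obtain b where b: "b \<ge> 0" "\<And>x t. \<bar>f (x + t) - f x\<bar> \<le> e / 4 + b * char_modulus t"
    using modulus_continuous[OF f, of "e / 4"] e by auto
  obtain m where m: "m \<ge> 1" "b * (jackson_const TYPE('n) / (real m)\<^sup>2) < e / 4"
    using jackson_const_small[of "e / 4"] e by auto
  define r where "r = exp (- (c / (2 * real m) powr \<tau>))"
  have r: "0 \<le> r" "r < 1" using c_pos m by (auto simp: r_def)
  define K where "K = (2 * real m + 3) ^ CARD('n)" 
  have "(\<lambda>n. K * r ^ n * (\<integral>x. \<bar>f x\<bar> \<partial>torus_haar)) \<longlonglongrightarrow> K * 0 * (\<integral>x. \<bar>f x\<bar> \<partial>torus_haar)"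
    using r by (intro tendsto_intros LIMSEQ_power_zero) auto
  then have "\<forall>\<^sub>F n in sequentially. K * r ^ n * (\<integral>x. \<bar>f x\<bar> \<partial>torus_haar) < e / 4"
    by (rule order_tendstoD) (use e in simp)
  then show "\<forall>\<^sub>F n in sequentially. \<forall>x\<in>UNIV. dist ((P ^^ n) f x) 0 < e"
  proof eventually_elim
    case (elim n)
    show ?case
    proof
      fix x
      have "\<bar>(P ^^ n) f x\<bar> \<le> e / 4 + b * (jackson_const TYPE('n) / (real m)\<^sup>2) + K * r ^ n * (\<integral>x. \<bar>f x\<bar> \<partial>torus_haar)"
        unfolding K_def r_def by (rule abs_P_pow_le_decay[OF m(1) f f0 b])
      then have "\<bar>(P ^^ n) f x\<bar> < e" using m(2) elim e by linarith
      then show "dist ((P ^^ n) f x) 0 < e" by simp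
    qed
  qed
qed

lemma P_pow_uniform:
  fixes f :: "'n torus \<Rightarrow> real"
  assumes f: "continuous_on UNIV f"
  shows "uniform_limit UNIV (\<lambda>n. (P ^^ n) f) (\<lambda>_. \<integral>x. f x \<partial>torus_haar) sequentially"
proof -
  let ?m = "\<integral>x. f x \<partial>torus_haar"
  have pc: "(P ^^ n) (\<lambda>_. ?m) = (\<lambda>_. ?m)" for n
    by (induction n) (auto simp: P_const)
  have "uniform_limit UNIV (\<lambda>n. (P ^^ n) (\<lambda>x. f x - ?m)) (\<lambda>_. 0) sequentially"
    using f
    by (intro P_pow_uniform_mean_zero continuous_intros)
      (simp_all add: Bochner_Integration.integral_diff integrable_torus_continuous torus_haar.prob_space[simplified])
  then show ?thesis
    by (simp add: P_pow_diff[OF f] pc uniform_limit_iff dist_real_def)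
qed

lemma P_pow_tendsto:
  fixes f :: "'n torus \<Rightarrow> real"
  assumes "continuous_on UNIV f"
  shows "(\<lambda>n. (P ^^ n) f x) \<longlonglongrightarrow> (\<integral>x. f x \<partial>torus_haar)"
  using tendsto_uniform_limitI[OF P_pow_uniform[OF assms]] by simp

text \<open>The iterates of \<open>f\<close> and of \<open>P f\<close> have the same limit, and that limit is the mean.\<close>
lemma integral_P:
  fixes f :: "'n torus \<Rightarrow> real"
  assumes f: "continuous_on UNIV f"
  shows "(\<integral>x. P f x \<partial>torus_haar) = (\<integral>x. f x \<partial>torus_haar)"
proof (rule LIMSEQ_unique)
  show "(\<lambda>n. (P ^^ n) (P f) 0) \<longlonglongrightarrow> (\<integral>x. P f x \<partial>torus_haar)"
    by (rule P_pow_tendsto[OF continuous_P[OF f]])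
  show "(\<lambda>n. (P ^^ n) (P f) 0) \<longlonglongrightarrow> (\<integral>x. f x \<partial>torus_haar)"
    using LIMSEQ_Suc[OF P_pow_tendsto[OF f, of 0]] by (simp add: funpow_swap1)
qed

text \<open>In other words, the Haar measure charges every nonempty open set. The coefficients of
  \<open>jackson m f\<close> are bounded by the integral of \<open>\<bar>f\<bar>\<close>, so these approximations to \<open>f\<close> vanish with it.
  Technically this is the decay estimate for the zeroth iterate.\<close>
lemma continuous_nonneg_integral_0:
  fixes f :: "'n torus \<Rightarrow> real"
  assumes f: "continuous_on UNIV f" and nn: "\<And>x. f x \<ge> 0" and f0: "(\<integral>x. f x \<partial>torus_haar) = 0"
  shows "f x = 0"
proof -
  have abs0: "(\<integral>x. \<bar>f x\<bar> \<partial>torus_haar) = 0" using nn f0 by simp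
  have "\<bar>f x\<bar> \<le> 0 + e" if e: "e > 0" for e
  proof -
    obtain b where b: "b \<ge> 0" "\<And>x t. \<bar>f (x + t) - f x\<bar> \<le> e / 2 + b * char_modulus t"
      using modulus_continuous[OF f, of "e / 2"] e by auto
    obtain m where m: "m \<ge> 1" "b * (jackson_const TYPE('n) / (real m)\<^sup>2) < e / 2"
      using jackson_const_small[of "e / 2"] e by auto
    have "\<bar>(P ^^ 0) f x\<bar> \<le> e / 2 + b * (jackson_const TYPE('n) / (real m)\<^sup>2)"
      using abs_P_pow_le_decay[OF m(1) f f0 b, of 0 x] by (simp add: abs0)
    then show ?thesis using m(2) by (simp only: funpow.simps id_apply)
  qed
  then have "\<bar>f x\<bar> \<le> 0" by (rule field_le_epsilon)
  then show ?thesis by simp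
qed

text \<open>Here \<open>\<alpha> > \<tau>\<close> is decisive. With degree \<open>m\<close> of order \<open>n powr \<beta>\<close> the approximation error is of order
  \<open>n powr - (\<alpha> * \<beta>)\<close> and the other term is of order
  \<open>n powr (d * \<beta>) * exp (- c' * n powr (1 - \<beta> * \<tau>))\<close> in dimension \<open>d\<close>. Both are summable as soon as
  \<open>1 / \<alpha> < \<beta> < 1 / \<tau>\<close>.\<close>
lemma P_pow_summable_bound:
  fixes f :: "'n torus \<Rightarrow> real"
  assumes hol: "holder_continuous \<alpha> f" and \<alpha>: "\<tau> < \<alpha>" "\<alpha> \<le> 1"
    and f: "continuous_on UNIV f" and f0: "(\<integral>x. f x \<partial>torus_haar) = 0"
  obtains q where "summable q" "\<And>n x. \<bar>(P ^^ n) f x\<bar> \<le> q n"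
proof -
  have \<alpha>0: "\<alpha> > 0" using \<alpha> tau_pos by linarith
  obtain H0 where H0: "\<And>x y. dist (f x) (f y) \<le> H0 * dist x y powr \<alpha>"
    using hol by (auto simp: holder_continuous_def)
  define H where "H = \<bar>H0\<bar>"
  have H: "H \<ge> 0" "\<And>x y. dist (f x) (f y) \<le> H * dist x y powr \<alpha>"
    unfolding H_def by (auto intro!: order_trans[OF H0] mult_right_mono simp del: dist_real_def)
  let ?I = "\<integral>x. \<bar>f x\<bar> \<partial>torus_haar" and ?J = "jackson_const TYPE('n)" and ?D = "CARD('n)"
  define \<beta> where "\<beta> = (1 / \<alpha> + 1 / \<tau>) / 2"
  have "1 / \<alpha> < 1 / \<tau>" using \<alpha> tau_pos by (simp add: frac_less2)
  then have "1 / \<alpha> < \<beta>" "\<beta> < 1 / \<tau>" by (auto simp: \<beta>_def)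
  then have \<beta>: "1 < \<alpha> * \<beta>" "\<beta> * \<tau> < 1" using \<alpha>0 tau_pos by (simp_all add: field_simps)
  have \<beta>0: "\<beta> > 0" using \<alpha>0 tau_pos by (simp add: \<beta>_def add_pos_pos)
  define \<delta> where "\<delta> = 1 - \<beta> * \<tau>"
  have \<delta>: "\<delta> > 0" using \<beta> by (simp add: \<delta>_def)
  define c' where "c' = c / 4 powr \<tau>"
  have c': "c' > 0" using c_pos by (simp add: c'_def)
  define q where "q n = H * (1 + ?J) * real n powr - (\<alpha> * \<beta>)
      + 7 ^ ?D * ?I * (real n powr (\<beta> * ?D) * exp (- (c' * real n powr \<delta>)))" for n :: nat
  have sq: "summable q" unfolding q_def
    using \<beta> by (intro summable_add summable_mult summable_powr_exp c' \<delta>) (simp add: summable_real_powr_iff)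
  have bound: "\<bar>(P ^^ n) f x\<bar> \<le> q n" if n: "n \<ge> 1" for n x
  proof -
    define y where "y = real n powr \<beta>"
    have y1: "y \<ge> 1" using n \<beta>0 by (simp add: y_def ge_one_powr_ge_zero)
    define m where "m = nat \<lceil>y\<rceil>"
    have m: "y \<le> real m" "real m \<le> 2 * y" "m \<ge> 1" using y1 unfolding m_def by linarith+
    have "\<bar>(P ^^ n) f x\<bar> \<le> H * real m powr - \<alpha> + (H * real m powr - \<alpha> * (real m)\<^sup>2) * (?J / (real m)\<^sup>2)
      + (2 * real m + 3) ^ ?D * exp (- (c / (2 * real m) powr \<tau>)) ^ n * ?I"
      using m H \<alpha>0 \<alpha>(2)
      by (intro abs_P_pow_le_decay f f0 modulus_holder) auto
    also have "H * real m powr - \<alpha> + (H * real m powr - \<alpha> * (real m)\<^sup>2) * (?J / (real m)\<^sup>2)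
        = H * (1 + ?J) * real m powr - \<alpha>"
      using m(3) by (simp add: algebra_simps)
    also have "\<dots> \<le> H * (1 + ?J) * y powr - \<alpha>"
      using m y1 \<alpha>0 H(1) jackson_const_nonneg[of "TYPE('n)"] by (intro mult_left_mono powr_mono2') auto
    also have "y powr - \<alpha> = real n powr - (\<alpha> * \<beta>)" by (simp add: y_def powr_powr mult.commute)
    also have "(2 * real m + 3) ^ ?D * exp (- (c / (2 * real m) powr \<tau>)) ^ n * ?I
        \<le> (7 * y) ^ ?D * exp (- (c' * real n powr \<delta>)) * ?I"
    proof (intro mult_right_mono mult_mono power_mono)
      have "c / (4 * y) powr \<tau> \<le> c / (2 * real m) powr \<tau>"
        using m y1 c_pos tau_pos by (intro divide_left_mono powr_mono2) auto
      then have "real n * (c / (4 * y) powr \<tau>) \<le> real n * (c / (2 * real m) powr \<tau>)"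
        by (intro mult_left_mono) auto
      moreover have "real n * (c / (4 * y) powr \<tau>) = c' * real n powr \<delta>"
        using n by (simp add: c'_def y_def powr_mult powr_powr \<delta>_def powr_diff)
      ultimately show "exp (- (c / (2 * real m) powr \<tau>)) ^ n \<le> exp (- (c' * real n powr \<delta>))"
        by (simp add: exp_of_nat_mult[symmetric])
    qed (use m y1 in auto)
    also have "(7 * y) ^ ?D = 7 ^ ?D * real n powr (\<beta> * ?D)"
      using n by (simp add: power_mult_distrib y_def powr_powr powr_realpow[symmetric])
    finally show ?thesis by (simp add: q_def mult_ac)
  qed
  obtain B where B: "\<And>x. norm (f x) \<le> B" using continuous_torus_bounded[OF f] by blast
  \<comment> \<open>At \<open>n = 0\<close> the expression \<open>q n\<close> is zero by the convention for \<open>0 powr\<close> and bounds nothing.\<close>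
  show thesis
  proof (rule that)
    show "summable (\<lambda>n. if n = 0 then B else q n)"
    proof (subst summable_cong)
      show "\<forall>\<^sub>F n in sequentially. (if n = 0 then B else q n) = q n"
        using eventually_gt_at_top[of 0] by eventually_elim simp
    qed (rule sq)
    show "\<bar>(P ^^ n) f x\<bar> \<le> (if n = 0 then B else q n)" for n x
      using bound[of n x] B[of x] by auto
  qed
qed

text \<open>The solution is the uniformly convergent Neumann series \<open>\<psi> = \<Sum>n. P\<^sup>n f\<close>.\<close>
lemma poisson_equation:
  fixes f :: "'n torus \<Rightarrow> real"
  assumes "holder_continuous \<alpha> f" and "\<tau> < \<alpha>" "\<alpha> \<le> 1"
    and f: "continuous_on UNIV f" and f0: "(\<integral>x. f x \<partial>torus_haar) = 0"
  obtains \<psi> where "continuous_on UNIV \<psi>" "\<And>x. f x = \<psi> x - P \<psi> x"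
proof -
  obtain q where q: "summable q" "\<And>n x. \<bar>(P ^^ n) f x\<bar> \<le> q n"
    using P_pow_summable_bound[OF assms] by blast
  define \<psi> where "\<psi> x = (\<Sum>n. (P ^^ n) f x)" for x
  have "uniform_limit UNIV (\<lambda>n x. \<Sum>i<n. (P ^^ i) f x) \<psi> sequentially"
    unfolding \<psi>_def using q by (intro Weierstrass_m_test) auto
  then have cont: "continuous_on UNIV \<psi>"
    by (rule uniform_limit_theorem[rotated])
      (auto intro!: always_eventually continuous_intros continuous_P_pow f)
  have sm: "summable (\<lambda>n. norm ((P ^^ n) f x))" for x
    using q by (intro summable_comparison_test[OF _ q(1)]) auto
  have "f x = \<psi> x - P \<psi> x" for x
  proof -
    have "P \<psi> x = (\<integral>w. (\<Sum>n. (P ^^ n) f (x + w)) \<partial>\<mu>)"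
      unfolding walk_avg_def[of \<mu> \<psi>] by (simp only: \<psi>_def)
    also have "\<dots> = (\<Sum>n. \<integral>w. (P ^^ n) f (x + w) \<partial>\<mu>)"
    proof (rule integral_suminf)
      show "integrable \<mu> (\<lambda>w. (P ^^ n) f (x + w))" for n
        by (intro integrable_step continuous_P_pow f)
      show "AE w in \<mu>. summable (\<lambda>n. norm ((P ^^ n) f (x + w)))" using sm by simp
      have "norm (\<integral>w. norm ((P ^^ n) f (x + w)) \<partial>\<mu>) \<le> q n" for n
      proof -
        have "(\<integral>w. norm ((P ^^ n) f (x + w)) \<partial>\<mu>) \<le> (\<integral>w. q n \<partial>\<mu>)"
          using q(2) by (intro integral_mono integrable_norm integrable_step continuous_P_pow f) auto
        then show ?thesis by (simp add: prob_space)
      qed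
      then show "summable (\<lambda>n. \<integral>w. norm ((P ^^ n) f (x + w)) \<partial>\<mu>)"
        by (intro summable_comparison_test[OF _ q(1)]) auto
    qed
    also have "\<dots> = (\<Sum>n. (P ^^ Suc n) f x)" by (simp add: walk_avg_def)
    also have "\<dots> = \<psi> x - f x"
      using suminf_split_head[OF summable_norm_cancel[OF sm[of x]]] by (simp add: \<psi>_def)
    finally show ?thesis by simp
  qed
  with cont show thesis using that by blast
qed

text \<open>By stationarity this is the variance of the martingale increment \<open>\<psi>(x + w) - P \<psi>(x)\<close>, with \<open>x\<close>
  Haar distributed and \<open>w\<close> of law \<open>\<mu>\<close>.\<close>
definition asymptotic_variance :: "('n torus \<Rightarrow> real) \<Rightarrow> real"
  where "asymptotic_variance \<psi> = (\<integral>x. (\<psi> x)\<^sup>2 - (P \<psi> x)\<^sup>2 \<partial>torus_haar)"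

text \<open>If the variance vanishes then \<open>\<psi>(x + w) = P \<psi>(x)\<close> for all \<open>x\<close> and some fixed step \<open>w\<close>. Since \<open>P\<close>
  commutes with translations, every \<open>P\<^sup>n \<psi>\<close> is then a translate of \<open>\<psi>\<close>. These translates converge
  uniformly to a constant, which is only possible if \<open>\<psi>\<close> is constant.\<close>
lemma asymptotic_variance_pos:
  fixes \<psi> :: "'n torus \<Rightarrow> real"
  assumes \<psi>: "continuous_on UNIV \<psi>" and ne: "\<psi> x - P \<psi> x \<noteq> 0"
  shows "asymptotic_variance \<psi> > 0"
proof -
  define v where "v x = P (\<lambda>y. (\<psi> y)\<^sup>2) x - (P \<psi> x)\<^sup>2" for x
  have c2: "continuous_on UNIV (\<lambda>y. (\<psi> y)\<^sup>2)" by (intro continuous_intros \<psi>)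
  have cv: "continuous_on UNIV v" unfolding v_def by (intro continuous_intros continuous_P c2 \<psi>)
  have ci: "continuous_on UNIV (\<lambda>y. (\<psi> y - r)\<^sup>2)" for r by (intro continuous_intros \<psi>)
  have v: "v x = (\<integral>w. (\<psi> (x + w) - P \<psi> x)\<^sup>2 \<partial>\<mu>)" for x
  proof -
    let ?p = "P \<psi> x"
    have "(\<integral>w. (\<psi> (x + w) - ?p)\<^sup>2 \<partial>\<mu>) = (\<integral>w. (\<psi> (x + w))\<^sup>2 - (2 * ?p) * \<psi> (x + w) + ?p\<^sup>2 \<partial>\<mu>)"
      by (simp add: power2_diff algebra_simps)
    also have "\<dots> = P (\<lambda>y. (\<psi> y)\<^sup>2) x - (2 * ?p) * ?p + ?p\<^sup>2"
      using integrable_step[OF c2, of x] integrable_step[OF \<psi>, of x]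
      by (simp add: walk_avg_def)
    finally show ?thesis by (simp add: v_def power2_eq_square)
  qed
  have v_nonneg: "v x \<ge> 0" for x unfolding v by simp
  have "asymptotic_variance \<psi> = (\<integral>x. v x \<partial>torus_haar)"
    unfolding asymptotic_variance_def v_def
    by (simp add: integrable_torus_continuous c2 \<psi> continuous_P integral_P continuous_intros)
  moreover have "(\<integral>x. v x \<partial>torus_haar) \<noteq> 0"
  proof
    assume "(\<integral>x. v x \<partial>torus_haar) = 0"
    then have v0: "v x = 0" for x
      using continuous_nonneg_integral_0[OF cv v_nonneg] by blast
    have AE: "AE w in \<mu>. \<psi> (x + w) = P \<psi> x" for x
      using v0[of x] integral_nonneg_eq_0_iff_AE[OF integrable_step[OF ci, of x "P \<psi> x"]]
      unfolding v by simp
    obtain D :: "'n torus set" where D: "countable D" "\<And>X. open X \<Longrightarrow> X \<noteq> {} \<Longrightarrow> \<exists>d\<in>D. d \<in> X"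
      using countable_dense_setE by metis
    have "AE w in \<mu>. \<forall>x\<in>D. \<psi> (x + w) = P \<psi> x"
      using AE D(1) by (simp add: AE_ball_countable)
    moreover have "ae_filter \<mu> \<noteq> bot"
      unfolding ae_filter_eq_bot_iff emeasure_space_1 by simp
    ultimately obtain w where w: "\<And>x. x \<in> D \<Longrightarrow> \<psi> (x + w) = P \<psi> x"
      using eventually_happens' by blast
    \<comment> \<open>The identity on a countable dense set, where one \<open>w\<close> works, extends by continuity.\<close>
    have w': "P \<psi> x = \<psi> (x + w)" for x
    proof (rule ccontr)
      assume ne: "P \<psi> x \<noteq> \<psi> (x + w)"
      have "open {x. P \<psi> x \<noteq> \<psi> (x + w)}"
        by (intro open_Collect_neq continuous_P \<psi> continuous_on_translate)
      with ne D(2)[of "{x. P \<psi> x \<noteq> \<psi> (x + w)}"] w show False by auto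
    qed
    have "\<exists>s. \<forall>x. (P ^^ n) \<psi> x = \<psi> (x + s)" for n
    proof (induction n)
      case (Suc n)
      then obtain s where s: "(P ^^ n) \<psi> = (\<lambda>x. \<psi> (x + s))" by blast
      have "P (\<lambda>x. \<psi> (x + s)) x = P \<psi> (x + s)" for x by (simp add: walk_avg_def add_ac)
      then have "(P ^^ Suc n) \<psi> x = \<psi> (x + (s + w))" for x by (simp add: s w' add_ac)
      then show ?case by blast
    qed (auto intro!: exI[of _ 0])
    then obtain s where s: "\<And>n x. (P ^^ n) \<psi> x = \<psi> (x + s n)" by metis
    have const: "\<psi> y = (\<integral>x. \<psi> x \<partial>torus_haar)" for y
    proof -
      have "dist (\<psi> y) (\<integral>x. \<psi> x \<partial>torus_haar) < e" if "e > 0" for e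
      proof -
        have "\<exists>n. \<forall>x\<in>UNIV. dist ((P ^^ n) \<psi> x) (\<integral>x. \<psi> x \<partial>torus_haar) < e"
          by (rule eventually_happens'[OF sequentially_bot uniform_limitD[OF P_pow_uniform[OF \<psi>] that]])
        then obtain n where n: "dist ((P ^^ n) \<psi> x) (\<integral>x. \<psi> x \<partial>torus_haar) < e" for x by blast
        from n[of "y - s n"] show ?thesis by (simp add: s)
      qed
      then show ?thesis using zero_less_dist_iff less_irrefl by blast
    qed
    have "P \<psi> x = \<psi> x" using w'[of x] const[of x] const[of "x + w"] by simp
    with ne show False by simp
  qed
  moreover have "(\<integral>x. v x \<partial>torus_haar) \<ge> 0" using v_nonneg by simp
  ultimately show ?thesis by linarith
qed

end

section \<open>Twisted operators and the characteristic function\<close>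

text \<open>A second-order Taylor expansion in \<open>s\<close> at one point. In the application \<open>a\<close>, \<open>p\<close>, \<open>b\<close>, \<open>q\<close> are the
  values of \<open>\<psi>\<close>, \<open>P \<psi>\<close>, \<open>b\<close>, \<open>P b\<close>, so that the first-order terms cancel by the Poisson equation and
  the second-order ones up to \<open>e\<close> by the choice of the corrector \<open>b\<close>. This uses
  \<open>f * p + f\<^sup>2 / 2 = (a\<^sup>2 - p\<^sup>2) / 2\<close>.\<close>
lemma approx_eigen_step:
  fixes s f p a b q V B e :: real
  assumes a: "a = f + p" and s: "\<bar>s\<bar> \<le> 1"
    and B: "\<bar>f\<bar> \<le> B" "\<bar>p\<bar> \<le> B" "\<bar>a\<bar> \<le> B" "\<bar>b\<bar> \<le> B" "\<bar>q\<bar> \<le> B" "\<bar>V\<bar> \<le> B"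
    and e: "\<bar>q - b + (V - (a\<^sup>2 - p\<^sup>2)) / 2\<bar> \<le> e"
  shows "cmod (iexp (s * f) * (1 + \<i> * s * p + s\<^sup>2 * q)
      - (1 - s\<^sup>2 * V / 2) * (1 + \<i> * s * a + s\<^sup>2 * b))
    \<le> s\<^sup>2 * e + (B ^ 3 * (1 + 2 * B) + 3 * B\<^sup>2 + 2 * B ^ 3) * \<bar>s\<bar> ^ 3"
proof -
  have B0: "B \<ge> 0" using B(1) by linarith
  have s1: "s\<^sup>2 \<le> 1" using s by (simp add: abs_square_le_1)
  have s4: "s ^ 4 \<le> \<bar>s\<bar> ^ 3" using s power_decreasing[of 3 4 "\<bar>s\<bar>"] by simp
  define R where "R = iexp (s * f) - (\<Sum>k\<le>2. (\<i> * (s * f)) ^ k / fact k)"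
  have R: "cmod R \<le> (\<bar>s\<bar> * B) ^ 3"
  proof -
    have "cmod R \<le> \<bar>s * f\<bar> ^ Suc 2 / fact (Suc 2)" unfolding R_def by (rule iexp_approx1)
    also have "\<dots> \<le> \<bar>s * f\<bar> ^ Suc 2 / 1"
      by (intro divide_left_mono fact_ge_1) auto
    also have "\<dots> = \<bar>s * f\<bar> ^ 3" by (simp add: eval_nat_numeral)
    also have "\<dots> \<le> (\<bar>s\<bar> * B) ^ 3" using B(1) by (intro power_mono) (auto simp: abs_mult intro!: mult_left_mono)
    finally show ?thesis .
  qed
  have iexp_eq: "iexp (s * f) = R + (1 + \<i> * s * f - s\<^sup>2 * f\<^sup>2 / 2)"
    unfolding R_def by (simp add: eval_nat_numeral power2_eq_square field_simps)
  define h where "h = 1 + \<i> * s * p + s\<^sup>2 * q"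
  have h: "cmod h \<le> 1 + 2 * B"
  proof -
    have "cmod h \<le> 1 + \<bar>s\<bar> * \<bar>p\<bar> + s\<^sup>2 * \<bar>q\<bar>"
      unfolding h_def by (intro norm_triangle_le add_mono) (auto simp: norm_mult norm_power)
    also have "\<dots> \<le> 1 + 1 * B + 1 * B"
      using s s1 B by (intro add_mono mult_mono) auto
    finally show ?thesis by simp
  qed
  define X where "X = q - b + (V - (a\<^sup>2 - p\<^sup>2)) / 2"
  define Y where "Y = f * q - f\<^sup>2 * p / 2 + V * a / 2"
  define Z where "Z = V * b / 2 - f\<^sup>2 * q / 2"
  have "iexp (s * f) * h - (1 - s\<^sup>2 * V / 2) * (1 + \<i> * s * a + s\<^sup>2 * b)
      = R * h + s\<^sup>2 * X + \<i> * s ^ 3 * Y + s ^ 4 * Z"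
    unfolding iexp_eq h_def X_def Y_def Z_def a
    by (simp add: field_simps power2_eq_square power3_eq_cube power4_eq_xxxx)
  also have "cmod \<dots> \<le> cmod R * cmod h + s\<^sup>2 * \<bar>X\<bar> + \<bar>s\<bar> ^ 3 * \<bar>Y\<bar> + s ^ 4 * \<bar>Z\<bar>"
    by (intro norm_triangle_le add_mono) (auto simp: norm_mult norm_power)
  also have "\<dots> \<le> (\<bar>s\<bar> * B) ^ 3 * (1 + 2 * B) + s\<^sup>2 * e + \<bar>s\<bar> ^ 3 * (2 * B\<^sup>2 + B ^ 3) + \<bar>s\<bar> ^ 3 * (B\<^sup>2 + B ^ 3)"
  proof (intro add_mono mult_mono R h s4)
    show "\<bar>X\<bar> \<le> e" using e by (simp add: X_def)
    have m2: "\<bar>x * y\<bar> \<le> B\<^sup>2" if "\<bar>x\<bar> \<le> B" "\<bar>y\<bar> \<le> B" for x y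
      using that B0 by (simp add: abs_mult power2_eq_square mult_mono)
    have m3: "\<bar>f\<^sup>2 * y\<bar> \<le> B ^ 3" if "\<bar>y\<bar> \<le> B" for y
      using mult_mono[OF m2[OF B(1) B(1)] that] B0
      by (simp add: abs_mult power2_eq_square power3_eq_cube)
    show "\<bar>Y\<bar> \<le> 2 * B\<^sup>2 + B ^ 3"
      using m2[OF B(1) B(5)] m3[OF B(2)] m2[OF B(6) B(3)] unfolding Y_def by linarith
    show "\<bar>Z\<bar> \<le> B\<^sup>2 + B ^ 3"
      using m2[OF B(6) B(4)] m3[OF B(5)] unfolding Z_def by linarith
  qed (use B0 in auto)
  also have "\<dots> = s\<^sup>2 * e + (B ^ 3 * (1 + 2 * B) + 3 * B\<^sup>2 + 2 * B ^ 3) * \<bar>s\<bar> ^ 3"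
    by (simp add: power_mult_distrib algebra_simps)
  finally show ?thesis by (simp add: h_def)
qed

context torus_walk
begin

text \<open>The operator whose \<open>n\<close>-th power applied to \<open>1\<close> is the characteristic function of the \<open>n\<close>-th
  Birkhoff sum, as a function of the starting point.\<close>
definition twisted :: "('n torus \<Rightarrow> real) \<Rightarrow> real \<Rightarrow> ('n torus \<Rightarrow> complex) \<Rightarrow> 'n torus \<Rightarrow> complex"
  where "twisted f s g x = iexp (s * f x) * P g x"

lemma continuous_twisted:
  assumes "continuous_on UNIV f" "continuous_on UNIV g"
  shows "continuous_on UNIV (twisted f s g)"
  unfolding twisted_def by (intro continuous_intros continuous_P assms)

lemma continuous_twisted_pow:
  assumes "continuous_on UNIV f" "continuous_on UNIV g"
  shows "continuous_on UNIV ((twisted f s ^^ n) g)"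
  by (induction n) (simp_all add: assms continuous_twisted)

lemma norm_twisted_le:
  assumes "continuous_on UNIV g" "\<And>x. cmod (g x) \<le> B"
  shows "cmod (twisted f s g x) \<le> B"
  using norm_P_le[OF assms] by (simp add: twisted_def norm_mult)

lemma norm_twisted_pow_le:
  assumes "continuous_on UNIV f" "continuous_on UNIV g" "\<And>x. cmod (g x) \<le> B"
  shows "cmod ((twisted f s ^^ n) g x) \<le> B"
  by (induction n arbitrary: x) (simp_all add: assms norm_twisted_le continuous_twisted_pow)

lemma twisted_diff:
  assumes "continuous_on UNIV g" "continuous_on UNIV h"
  shows "twisted f s (\<lambda>x. g x - h x) = (\<lambda>x. twisted f s g x - twisted f s h x)"
  by (rule ext) (simp add: twisted_def P_diff[OF assms] right_diff_distrib)

lemma twisted_pow_diff: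
  assumes "continuous_on UNIV f" "continuous_on UNIV g" "continuous_on UNIV h"
  shows "(twisted f s ^^ n) (\<lambda>x. g x - h x) = (\<lambda>x. (twisted f s ^^ n) g x - (twisted f s ^^ n) h x)"
  by (induction n) (simp_all add: twisted_diff continuous_twisted_pow assms)

lemma twisted_mult: "twisted f s (\<lambda>x. c * g x) x = c * twisted f s g x"
  by (simp add: twisted_def P_mult)

text \<open>The defect of an approximate eigenfunction accumulates at most linearly, because neither the
  operator nor the eigenvalue expands.\<close>
lemma twisted_pow_approx_eigen:
  assumes f: "continuous_on UNIV f" and h: "continuous_on UNIV h"
    and E: "\<And>x. cmod (twisted f s h x - l * h x) \<le> E" and l: "cmod l \<le> 1"
  shows "cmod ((twisted f s ^^ n) h x - l ^ n * h x) \<le> n * E"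
proof (induction n arbitrary: x)
  case (Suc n)
  let ?T = "twisted f s" and ?g = "(twisted f s ^^ n) h"
  have g: "continuous_on UNIV ?g" by (rule continuous_twisted_pow[OF f h])
  have lh: "continuous_on UNIV (\<lambda>x. l ^ n * h x)" by (intro continuous_intros h)
  have "(?T ^^ Suc n) h x - l ^ Suc n * h x
      = ?T (\<lambda>x. ?g x - l ^ n * h x) x + l ^ n * (?T h x - l * h x)"
    by (simp add: twisted_diff[OF g lh] twisted_mult) (simp add: algebra_simps)
  also have "cmod \<dots> \<le> n * E + 1 * E"
  proof (intro norm_triangle_le add_mono)
    show "cmod (?T (\<lambda>x. ?g x - l ^ n * h x) x) \<le> n * E"
      by (intro norm_twisted_le continuous_intros g h Suc.IH)
    have "E \<ge> 0" using norm_ge_zero order_trans E by blast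
    then show "cmod (l ^ n * (?T h x - l * h x)) \<le> 1 * E"
      unfolding norm_mult norm_power using l E by (intro mult_mono power_le_one) auto
  qed
  finally show ?case by (simp add: algebra_simps)
qed simp

end

context diophantine_walk
begin

text \<open>Truncating the Neumann series at \<open>m\<close> leaves the defect \<open>P\<^sup>m g\<close>, which is uniformly small. A
  continuous \<open>g\<close> need not have an exact corrector, as its Neumann series may diverge.\<close>
lemma approx_corrector:
  fixes g :: "'n torus \<Rightarrow> real"
  assumes g: "continuous_on UNIV g" and g0: "(\<integral>x. g x \<partial>torus_haar) = 0" and e: "e > 0"
  obtains b where "continuous_on UNIV b" "\<And>x. \<bar>g x - (b x - P b x)\<bar> \<le> e"
proof -
  have "\<exists>m. \<forall>x\<in>UNIV. dist ((P ^^ m) g x) 0 < e"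
    by (rule eventually_happens'[OF sequentially_bot uniform_limitD[OF P_pow_uniform_mean_zero[OF g g0] e]])
  then obtain m where m: "\<And>x. \<bar>(P ^^ m) g x\<bar> < e" by auto
  define b where "b x = (\<Sum>j<m. (P ^^ j) g x)" for x
  have b: "continuous_on UNIV b" unfolding b_def by (intro continuous_intros continuous_P_pow g)
  have "P b x = (\<Sum>j<m. (P ^^ Suc j) g x)" for x
    unfolding b_def[abs_def] by (subst P_sum) (simp_all add: continuous_P_pow g)
  then have "b x - P b x = g x - (P ^^ m) g x" for x
    using sum_lessThan_telescope'[of "\<lambda>j. (P ^^ j) g x" m] by (simp add: b_def sum_subtractf)
  then show thesis using that[of b] b m by (simp add: less_imp_le)
qed

text \<open>The function \<open>h = 1 + i s \<psi> + s\<^sup>2 b\<close> is an approximate eigenfunction with eigenvalue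
  \<open>1 - s\<^sup>2 V / 2\<close> and defect \<open>s\<^sup>2 \<epsilon> + O(s\<^sup>3)\<close>. For \<open>s = t / \<surd>n\<close> the defects of \<open>n\<close> steps add up to
  \<open>t\<^sup>2 \<epsilon> + O(1 / \<surd>n)\<close>, replacing \<open>h\<close> by \<open>1\<close> costs \<open>O(s)\<close>, and the eigenvalue to the power \<open>n\<close>
  tends to \<open>exp (- t\<^sup>2 V / 2)\<close>. This replaces a martingale central limit theorem.\<close>
theorem twisted_pow_tendsto:
  fixes f \<psi> :: "'n torus \<Rightarrow> real"
  assumes f: "continuous_on UNIV f" and \<psi>: "continuous_on UNIV \<psi>" and eq: "\<And>x. f x = \<psi> x - P \<psi> x"
  shows "(\<lambda>n. (twisted f (t / sqrt n) ^^ n) (\<lambda>_. 1) x) \<longlonglongrightarrow> of_real (exp (- (t\<^sup>2 * asymptotic_variance \<psi>) / 2))"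
proof -
  define V where "V = asymptotic_variance \<psi>"
  define s where "s n = t / sqrt (real n)" for n :: nat
  define l where "l n = 1 - (s n)\<^sup>2 * V / 2" for n
  have s0: "s \<longlonglongrightarrow> 0"
    unfolding s_def by (intro tendsto_divide_0[OF tendsto_const] filterlim_at_top_imp_at_infinity
        filterlim_compose[OF sqrt_at_top] filterlim_real_sequentially)
  have s2: "real n * (s n)\<^sup>2 = t\<^sup>2" if "n > 0" for n
    using that by (simp add: s_def power_divide)
  have V0: "V \<ge> 0"
  proof (cases "\<exists>x. \<psi> x - P \<psi> x \<noteq> 0")
    case True
    then show ?thesis using asymptotic_variance_pos[OF \<psi>] unfolding V_def by fastforce
  qed (simp add: V_def asymptotic_variance_def)
  have lim_l: "(\<lambda>n. l n ^ n) \<longlonglongrightarrow> exp (- (t\<^sup>2 * V) / 2)"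
  proof -
    have "(\<lambda>n. (1 + (- (t\<^sup>2 * V) / 2) / real n) ^ n) \<longlonglongrightarrow> exp (- (t\<^sup>2 * V) / 2)"
      by (rule tendsto_exp_limit_sequentially)
    moreover have "(1 + (- (t\<^sup>2 * V) / 2) / real n) ^ n = l n ^ n" for n
      by (simp add: l_def s_def power_divide mult.commute)
    ultimately show ?thesis by simp
  qed
  have l1: "\<forall>\<^sub>F n in sequentially. \<bar>l n\<bar> \<le> 1"
  proof -
    have "(\<lambda>n. (s n)\<^sup>2 * V / 2) \<longlonglongrightarrow> 0\<^sup>2 * V / 2" by (intro tendsto_intros s0) auto
    then have "\<forall>\<^sub>F n in sequentially. (s n)\<^sup>2 * V / 2 < 1" by (rule order_tendstoD) simp
    then show ?thesis
    proof eventually_elim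
      case (elim n)
      moreover have "(s n)\<^sup>2 * V / 2 \<ge> 0" using V0 by simp
      ultimately show ?case by (simp add: l_def)
    qed
  qed
  let ?u = "\<lambda>n. (twisted f (s n) ^^ n) (\<lambda>_. 1) x"
  have "(\<lambda>n. ?u n - of_real (l n ^ n)) \<longlonglongrightarrow> 0"
  proof (rule tendstoI)
    fix e :: real assume e: "e > 0"
    \<comment> \<open>The corrector has to be good enough for its total contribution \<open>t\<^sup>2 * \<epsilon>\<close> to stay below \<open>e\<close>.\<close>
    define \<epsilon> where "\<epsilon> = e / (2 * (1 + t\<^sup>2))"
    have \<epsilon>: "\<epsilon> > 0" "t\<^sup>2 * \<epsilon> < e"
    proof -
      have p: "1 + t\<^sup>2 > 0" by (smt (verit) zero_le_power2)
      then show "\<epsilon> > 0" using e by (simp add: \<epsilon>_def)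
      have "e * t\<^sup>2 \<ge> 0" using e by simp
      moreover have "e * (2 * (1 + t\<^sup>2)) = 2 * e + 2 * (e * t\<^sup>2)" by (simp add: algebra_simps)
      ultimately have "t\<^sup>2 * e < e * (2 * (1 + t\<^sup>2))" using e by (simp only: mult.commute[of "t\<^sup>2" e])
      then show "t\<^sup>2 * \<epsilon> < e" using p by (simp add: \<epsilon>_def divide_less_eq)
    qed
    have cp: "continuous_on UNIV (P \<psi>)" by (rule continuous_P[OF \<psi>])
    define g where "g x = (V - ((\<psi> x)\<^sup>2 - (P \<psi> x)\<^sup>2)) / 2" for x
    have cg: "continuous_on UNIV g" unfolding g_def by (intro continuous_intros \<psi> cp) auto
    have "integrable torus_haar (\<lambda>x. (\<psi> x)\<^sup>2 - (P \<psi> x)\<^sup>2)"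
      by (intro integrable_torus_continuous continuous_intros \<psi> cp)
    then have g0: "(\<integral>x. g x \<partial>torus_haar) = 0"
      by (simp add: g_def V_def asymptotic_variance_def torus_haar.prob_space[simplified])
    obtain b where b: "continuous_on UNIV b" "\<And>x. \<bar>g x - (b x - P b x)\<bar> \<le> \<epsilon>"
      using approx_corrector[OF cg g0 \<epsilon>(1)] by blast
    have cq: "continuous_on UNIV (P b)" by (rule continuous_P[OF b(1)])
    obtain B1 where B1: "\<And>x. norm (f x) \<le> B1" using continuous_torus_bounded[OF f] by blast
    obtain B2 where B2: "\<And>x. norm (\<psi> x) \<le> B2" using continuous_torus_bounded[OF \<psi>] by blast
    obtain B3 where B3: "\<And>x. norm (b x) \<le> B3" using continuous_torus_bounded[OF b(1)] by blast
    define B where "B = max (max B1 B2) (max B3 \<bar>V\<bar>)"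
    have B: "\<bar>f x\<bar> \<le> B" "\<bar>\<psi> x\<bar> \<le> B" "\<bar>b x\<bar> \<le> B" "\<bar>V\<bar> \<le> B" for x
      using B1[of x] B2[of x] B3[of x] by (auto simp: B_def)
    have B': "\<bar>P \<psi> x\<bar> \<le> B" "\<bar>P b x\<bar> \<le> B" for x
      using norm_P_le[OF \<psi>, of B x] norm_P_le[OF b(1), of B x] B by auto
    define K where "K = B ^ 3 * (1 + 2 * B) + 3 * B\<^sup>2 + 2 * B ^ 3"
    define h where "h n x = 1 + \<i> * s n * \<psi> x + (s n)\<^sup>2 * b x" for n x
    have ch: "continuous_on UNIV (h n)" for n unfolding h_def by (intro continuous_intros \<psi> b(1))
    have Ph: "P (h n) x = 1 + \<i> * s n * P \<psi> x + (s n)\<^sup>2 * P b x" for n x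
    proof -
      have "P (h n) x = P (\<lambda>x. 1 + (\<i> * s n) * complex_of_real (\<psi> x)) x + P (\<lambda>x. of_real ((s n)\<^sup>2) * complex_of_real (b x)) x"
        unfolding h_def[abs_def] by (subst P_add[symmetric]) (auto intro!: continuous_intros \<psi> b(1) simp: mult_ac)
      also have "P (\<lambda>x. 1 + (\<i> * s n) * complex_of_real (\<psi> x)) x = P (\<lambda>x. 1) x + P (\<lambda>x. (\<i> * s n) * complex_of_real (\<psi> x)) x"
        by (subst P_add[symmetric]) (auto intro!: continuous_intros \<psi>)
      finally show ?thesis by (simp only: P_mult P_const P_of_real) (simp add: mult_ac)
    qed
    have hB: "cmod (1 - h n x) \<le> \<bar>s n\<bar> * B + (s n)\<^sup>2 * B" for n x
    proof -
      have "cmod (1 - h n x) = cmod (\<i> * s n * \<psi> x + (s n)\<^sup>2 * b x)"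
        unfolding h_def by (subst norm_minus_cancel[symmetric]) simp
      also have "\<dots> \<le> \<bar>s n\<bar> * \<bar>\<psi> x\<bar> + (s n)\<^sup>2 * \<bar>b x\<bar>"
        by (intro norm_triangle_le add_mono) (auto simp: norm_mult norm_power)
      also have "\<dots> \<le> \<bar>s n\<bar> * B + (s n)\<^sup>2 * B" using B by (intro add_mono mult_left_mono) auto
      finally show ?thesis .
    qed
    let ?F = "\<lambda>n. 2 * (\<bar>s n\<bar> * B + (s n)\<^sup>2 * B) + (t\<^sup>2 * \<epsilon> + K * t\<^sup>2 * \<bar>s n\<bar>)"
    have bound: "cmod (?u n - of_real (l n ^ n)) \<le> ?F n" if n: "n > 0" and sn: "\<bar>s n\<bar> \<le> 1" and ln: "\<bar>l n\<bar> \<le> 1" for n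
    proof -
      have E: "cmod (twisted f (s n) (h n) x - of_real (l n) * h n x) \<le> (s n)\<^sup>2 * \<epsilon> + K * \<bar>s n\<bar> ^ 3" for x
      proof -
        have "\<bar>P b x - b x + (V - ((\<psi> x)\<^sup>2 - (P \<psi> x)\<^sup>2)) / 2\<bar> \<le> \<epsilon>"
          using b(2)[of x] unfolding g_def by linarith
        moreover have "\<psi> x = f x + P \<psi> x" using eq[of x] by simp
        ultimately show ?thesis
          using approx_eigen_step[OF _ sn B(1)[of x] B'(1)[of x] B(2)[of x] B(3)[of x] B'(2)[of x] B(4), of \<epsilon>]
          by (simp add: twisted_def Ph h_def l_def K_def)
      qed
      have 1: "cmod ((twisted f (s n) ^^ n) (h n) x - of_real (l n) ^ n * h n x) \<le> n * ((s n)\<^sup>2 * \<epsilon> + K * \<bar>s n\<bar> ^ 3)"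
        using ln by (intro twisted_pow_approx_eigen f ch E) simp
      have 2: "cmod (?u n - (twisted f (s n) ^^ n) (h n) x) \<le> \<bar>s n\<bar> * B + (s n)\<^sup>2 * B"
      proof -
        have c1: "continuous_on UNIV (\<lambda>x :: 'n torus. 1 :: complex)" by (intro continuous_intros)
        have "cmod ((twisted f (s n) ^^ n) (\<lambda>x. 1 - h n x) x) \<le> \<bar>s n\<bar> * B + (s n)\<^sup>2 * B"
          by (intro norm_twisted_pow_le f continuous_intros ch hB)
        then show ?thesis by (simp add: twisted_pow_diff[OF f c1 ch])
      qed
      have 3: "cmod (of_real (l n) ^ n * h n x - of_real (l n) ^ n) \<le> \<bar>s n\<bar> * B + (s n)\<^sup>2 * B"
      proof -
        have "cmod (of_real (l n) ^ n * h n x - of_real (l n) ^ n) = \<bar>l n\<bar> ^ n * cmod (1 - h n x)"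
        proof -
          have "of_real (l n) ^ n * h n x - of_real (l n) ^ n = - (of_real (l n) ^ n * (1 - h n x))"
            by (simp add: algebra_simps)
          then show ?thesis by (simp only: norm_minus_cancel norm_mult norm_power norm_of_real)
        qed
        also have "\<dots> \<le> 1 * (\<bar>s n\<bar> * B + (s n)\<^sup>2 * B)"
          using ln by (intro mult_mono hB power_le_one) auto
        finally show ?thesis by simp
      qed
      have "real n * ((s n)\<^sup>2 * \<epsilon> + K * \<bar>s n\<bar> ^ 3) = (real n * (s n)\<^sup>2) * \<epsilon> + K * (real n * (s n)\<^sup>2) * \<bar>s n\<bar>"
        by (simp add: algebra_simps power3_eq_cube power2_eq_square)
      also have "\<dots> = t\<^sup>2 * \<epsilon> + K * t\<^sup>2 * \<bar>s n\<bar>" by (simp only: s2[OF n])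
      finally have 4: "real n * ((s n)\<^sup>2 * \<epsilon> + K * \<bar>s n\<bar> ^ 3) = t\<^sup>2 * \<epsilon> + K * t\<^sup>2 * \<bar>s n\<bar>" .
      show ?thesis
        using norm_diff_triangle_le[OF norm_diff_triangle_le[OF 2 1] 3] unfolding 4 by (simp add: algebra_simps)
    qed
    have "?F \<longlonglongrightarrow> 2 * (\<bar>0\<bar> * B + 0\<^sup>2 * B) + (t\<^sup>2 * \<epsilon> + K * t\<^sup>2 * \<bar>0\<bar>)"
      by (intro tendsto_intros s0)
    then have "\<forall>\<^sub>F n in sequentially. ?F n < e"
      by (rule order_tendstoD) (use \<epsilon> in simp)
    moreover have "\<forall>\<^sub>F n in sequentially. \<bar>s n\<bar> < 1"
      using tendsto_rabs[OF s0] by (rule order_tendstoD) simp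
    ultimately show "\<forall>\<^sub>F n in sequentially. dist (?u n - of_real (l n ^ n)) 0 < e"
      using l1 eventually_gt_at_top[of 0]
    proof eventually_elim
      case (elim n)
      then show ?case using bound[of n] by simp
    qed
  qed
  then have "(\<lambda>n. (?u n - of_real (l n ^ n)) + of_real (l n ^ n)) \<longlonglongrightarrow> 0 + of_real (exp (- (t\<^sup>2 * V) / 2))"
    by (intro tendsto_add tendsto_of_real lim_l)
  then show ?thesis by (simp add: s_def V_def)
qed

end

section \<open>The random walk and the central limit theorems\<close>

context torus_walk
begin

abbreviation steps :: "(nat \<Rightarrow> 'n torus) measure"
  where "steps \<equiv> \<Pi>\<^sub>M i\<in>UNIV. \<mu>"

lemma sequence_space_steps: "sequence_space \<mu>"
  by (intro sequence_space.intro product_prob_space.intro product_prob_space_axioms.intro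
      product_sigma_finite.intro sigma_finite_measure_axioms prob_space_axioms)

lemma prob_space_steps: "prob_space steps"
proof -
  interpret S: sequence_space \<mu> by (rule sequence_space_steps)
  show ?thesis by unfold_locales
qed

lemma measurable_step [measurable]: "(\<lambda>\<omega>. \<omega> i) \<in> steps \<rightarrow>\<^sub>M borel"
  using measurable_component_singleton[of i UNIV "\<lambda>_. \<mu>"]
  by (simp add: measurable_cong_sets[OF refl sets_mu])

lemma space_steps: "space steps = UNIV"
  by (simp add: space_PiM)

lemma measurable_walk:
  assumes [measurable]: "X \<in> M \<rightarrow>\<^sub>M borel" "W \<in> M \<rightarrow>\<^sub>M steps"
  shows "(\<lambda>z. walk (X z) (W z) j) \<in> M \<rightarrow>\<^sub>M borel"
proof -
  have [measurable]: "(\<lambda>z. W z i) \<in> M \<rightarrow>\<^sub>M borel" for i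
    using measurable_compose[OF assms(2) measurable_step] .
  show ?thesis unfolding walk_def by measurable
qed

lemma measurable_birkhoff_sum:
  assumes f: "f \<in> borel_measurable borel" and "X \<in> M \<rightarrow>\<^sub>M borel" "W \<in> M \<rightarrow>\<^sub>M steps"
  shows "(\<lambda>z. birkhoff_sum f n (X z) (W z)) \<in> borel_measurable M"
  unfolding birkhoff_sum_def
  by (intro borel_measurable_sum measurable_compose[OF measurable_walk f] assms)

lemma birkhoff_sum_case_nat:
  "birkhoff_sum f (Suc n) x (case_nat w \<omega>) = f x + birkhoff_sum f n (x + w) \<omega>"
proof -
  have "walk x (case_nat w \<omega>) (Suc j) = walk (x + w) \<omega> j" for j
    by (simp only: walk_def sum.lessThan_Suc_shift nat.case) (simp add: add.assoc)
  then show ?thesis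
    by (simp only: birkhoff_sum_def sum.lessThan_Suc_shift) (simp add: walk_def)
qed

text \<open>Conditioning on the first step: a walk is its first step followed by an independent walk from the
  new position.\<close>
lemma expectation_iexp_birkhoff_sum:
  assumes f: "continuous_on UNIV f"
  shows "(\<integral>\<omega>. iexp (s * birkhoff_sum f n x \<omega>) \<partial>steps) = (twisted f s ^^ n) (\<lambda>_. 1) x"
proof (induction n arbitrary: x)
  case 0
  interpret S: prob_space steps by (rule prob_space_steps)
  show ?case using S.prob_space by (simp add: birkhoff_sum_def)
next
  case (Suc n)
  interpret S: sequence_space \<mu> by (rule sequence_space_steps)
  interpret pair_prob_space \<mu> steps ..
  have [measurable]: "f \<in> borel_measurable borel" using f by (rule borel_measurable_continuous_onI)
  have [measurable]: "(\<lambda>\<omega>. birkhoff_sum f n x \<omega>) \<in> borel_measurable steps" for n x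
    by (rule measurable_birkhoff_sum) measurable
  have [measurable]: "(\<lambda>z. birkhoff_sum f n (x + fst z) (snd z)) \<in> borel_measurable (\<mu> \<Otimes>\<^sub>M steps)"
    by (rule measurable_birkhoff_sum) measurable
  have "(\<integral>\<omega>. iexp (s * birkhoff_sum f (Suc n) x \<omega>) \<partial>steps)
      = (\<integral>\<omega>. iexp (s * birkhoff_sum f (Suc n) x \<omega>) \<partial>distr (\<mu> \<Otimes>\<^sub>M steps) steps (\<lambda>(w, \<omega>). case_nat w \<omega>))"
    by (simp only: S.PiM_iter)
  also have "\<dots> = (\<integral>z. iexp (s * birkhoff_sum f (Suc n) x (case z of (w, \<omega>) \<Rightarrow> case_nat w \<omega>)) \<partial>(\<mu> \<Otimes>\<^sub>M steps))"
    by (rule integral_distr) measurable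
  also have "\<dots> = (\<integral>z. iexp (s * f x) * iexp (s * birkhoff_sum f n (x + fst z) (snd z)) \<partial>(\<mu> \<Otimes>\<^sub>M steps))"
    by (intro Bochner_Integration.integral_cong refl)
      (simp add: case_prod_unfold birkhoff_sum_case_nat distrib_left exp_add)
  also have "\<dots> = iexp (s * f x) * (\<integral>z. iexp (s * birkhoff_sum f n (x + fst z) (snd z)) \<partial>(\<mu> \<Otimes>\<^sub>M steps))"
    by simp
  also have "(\<integral>z. iexp (s * birkhoff_sum f n (x + fst z) (snd z)) \<partial>(\<mu> \<Otimes>\<^sub>M steps))
      = (\<integral>w. \<integral>\<omega>. iexp (s * birkhoff_sum f n (x + w) \<omega>) \<partial>steps \<partial>\<mu>)"
  proof -
    have "integrable (\<mu> \<Otimes>\<^sub>M steps) (\<lambda>z. iexp (s * birkhoff_sum f n (x + fst z) (snd z)))"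
      by (rule P.integrable_const_bound[of _ 1]) auto
    from integral_fst'[OF this] show ?thesis by simp
  qed
  also have "\<dots> = P ((twisted f s ^^ n) (\<lambda>_. 1)) x" by (simp only: Suc walk_avg_def)
  finally show ?case by (simp add: twisted_def[of f s "(twisted f s ^^ n) (\<lambda>_. 1)" x])
qed

end

lemma cdf_std_normal: "cdf std_normal_distribution t = (LINT x:{..t}|lborel. exp (- x\<^sup>2 / 2) / sqrt (2 * pi))"
proof -
  have "cdf std_normal_distribution t = (\<integral>x. indicator {..t} x \<partial>std_normal_distribution)"
    by (simp add: cdf_def)
  also have "\<dots> = (\<integral>x. std_normal_density x * indicator {..t} x \<partial>lborel)"
    by (subst integral_density) auto
  finally show ?thesis
    by (simp add: set_lebesgue_integral_def std_normal_density_def mult.commute)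
qed

lemma isCont_cdf_std_normal: "isCont (cdf std_normal_distribution) t"
proof -
  interpret real_distribution std_normal_distribution by (rule real_dist_normal_dist)
  have "emeasure std_normal_distribution {t} = (\<integral>\<^sup>+x. ennreal (std_normal_density x) * indicator {t} x \<partial>lborel)"
    by (subst emeasure_density) auto
  also have "\<dots> = 0" by (subst nn_integral_0_iff_AE) (auto intro: AE_mp[OF AE_lborel_singleton[of t]] simp: indicator_def)
  finally have "measure std_normal_distribution {t} = 0" by (simp add: measure_def)
  then show ?thesis by (simp add: isCont_cdf)
qed

context diophantine_walk
begin

text \<open>The sum has \<open>n + 1\<close> terms, but its normalisation, hence the twist parameter, is that of \<open>n\<close>. So
  its characteristic function is one further application of the twisted operator, whose factor
  \<open>iexp (s * f x)\<close> tends to \<open>1\<close> and whose average \<open>P\<close> preserves bounded pointwise limits.\<close>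
lemma quenched_clt:
  fixes f \<psi> :: "'n torus \<Rightarrow> real"
  assumes f: "continuous_on UNIV f" and \<psi>: "continuous_on UNIV \<psi>" and eq: "\<And>x. f x = \<psi> x - P \<psi> x"
    and \<sigma>: "\<sigma> > 0" "asymptotic_variance \<psi> = \<sigma>\<^sup>2"
  shows "weak_conv_m (\<lambda>n. distr steps borel (\<lambda>\<omega>. birkhoff_sum f (Suc n) x \<omega> / (\<sigma> * sqrt (real n)))) std_normal_distribution"
proof (rule levy_continuity)
  interpret S: prob_space steps by (rule prob_space_steps)
  have [measurable]: "f \<in> borel_measurable borel" using f by (rule borel_measurable_continuous_onI)
  have [measurable]: "(\<lambda>\<omega>. birkhoff_sum f n x \<omega>) \<in> borel_measurable steps" for n
    by (rule measurable_birkhoff_sum) measurable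
  show "real_distribution (distr steps borel (\<lambda>\<omega>. birkhoff_sum f (Suc n) x \<omega> / (\<sigma> * sqrt (real n))))" for n
    by (rule S.real_distribution_distr) measurable
  show "real_distribution std_normal_distribution" by (rule real_dist_normal_dist)
  fix t
  let ?s = "\<lambda>n. t / \<sigma> / sqrt (real n)"
  let ?u = "\<lambda>n. (twisted f (?s n) ^^ n) (\<lambda>_. 1)"
  have lim: "(\<lambda>n. ?u n y) \<longlonglongrightarrow> of_real (exp (- t\<^sup>2 / 2))" for y
    using twisted_pow_tendsto[OF f \<psi> eq, of "t / \<sigma>" y] \<sigma> by (simp add: power_divide)
  have cu: "continuous_on UNIV (?u n)" for n by (intro continuous_twisted_pow f continuous_intros)
  have "char (distr steps borel (\<lambda>\<omega>. birkhoff_sum f (Suc n) x \<omega> / (\<sigma> * sqrt (real n)))) t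
      = iexp (?s n * f x) * P (?u n) x" for n
  proof -
    have "char (distr steps borel (\<lambda>\<omega>. birkhoff_sum f (Suc n) x \<omega> / (\<sigma> * sqrt (real n)))) t
        = (\<integral>\<omega>. iexp (?s n * birkhoff_sum f (Suc n) x \<omega>) \<partial>steps)"
      unfolding char_def by (subst integral_distr) auto
    also have "\<dots> = (twisted f (?s n) ^^ Suc n) (\<lambda>_. 1) x"
      by (rule expectation_iexp_birkhoff_sum[OF f])
    finally show ?thesis by (simp add: twisted_def)
  qed
  moreover have "(\<lambda>n. iexp (?s n * f x) * P (?u n) x) \<longlonglongrightarrow> iexp (0 * f x) * of_real (exp (- t\<^sup>2 / 2))"
  proof (rule tendsto_mult)
    have "?s \<longlonglongrightarrow> 0"
      by (intro tendsto_divide_0[OF tendsto_const] filterlim_at_top_imp_at_infinity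
          filterlim_compose[OF sqrt_at_top] filterlim_real_sequentially)
    then show "(\<lambda>n. iexp (?s n * f x)) \<longlonglongrightarrow> iexp (0 * f x)" by (intro tendsto_intros)
    have "(\<lambda>n. \<integral>w. ?u n (x + w) \<partial>\<mu>) \<longlonglongrightarrow> (\<integral>w. of_real (exp (- t\<^sup>2 / 2)) \<partial>\<mu>)"
    proof (rule integral_dominated_convergence[where w = "\<lambda>_. 1"])
      show "(\<lambda>w. ?u n (x + w)) \<in> borel_measurable \<mu>" for n
        by (rule borel_measurable_integrable[OF integrable_step[OF cu]])
      show "AE w in \<mu>. norm (?u n (x + w)) \<le> 1" for n
        by (intro AE_I2 norm_twisted_pow_le f continuous_intros) auto
    qed (use lim in auto)
    then show "(\<lambda>n. P (?u n) x) \<longlonglongrightarrow> of_real (exp (- t\<^sup>2 / 2))"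
      by (simp add: walk_avg_def)
  qed
  ultimately show "(\<lambda>n. char (distr steps borel (\<lambda>\<omega>. birkhoff_sum f (Suc n) x \<omega> / (\<sigma> * sqrt (real n)))) t)
      \<longlonglongrightarrow> char std_normal_distribution t"
    by (simp add: char_std_normal_distribution)
qed

lemma quenched_clt_cdf:
  fixes f \<psi> :: "'n torus \<Rightarrow> real"
  assumes f: "continuous_on UNIV f" and \<psi>: "continuous_on UNIV \<psi>" and eq: "\<And>x. f x = \<psi> x - P \<psi> x"
    and \<sigma>: "\<sigma> > 0" "asymptotic_variance \<psi> = \<sigma>\<^sup>2"
  shows "(\<lambda>n. measure steps {\<omega>. birkhoff_sum f (Suc n) x \<omega> / (\<sigma> * sqrt (real n)) \<le> t})
    \<longlonglongrightarrow> (LINT x:{..t}|lborel. exp (- x\<^sup>2 / 2) / sqrt (2 * pi))"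
proof -
  have [measurable]: "f \<in> borel_measurable borel" using f by (rule borel_measurable_continuous_onI)
  have [measurable]: "(\<lambda>\<omega>. birkhoff_sum f n x \<omega>) \<in> borel_measurable steps" for n
    by (rule measurable_birkhoff_sum) measurable
  have "cdf (distr steps borel (\<lambda>\<omega>. birkhoff_sum f (Suc n) x \<omega> / (\<sigma> * sqrt (real n)))) t
      = measure steps {\<omega>. birkhoff_sum f (Suc n) x \<omega> / (\<sigma> * sqrt (real n)) \<le> t}" for n
    unfolding cdf_def by (subst measure_distr) (auto simp: vimage_def space_steps)
  moreover have "(\<lambda>n. cdf (distr steps borel (\<lambda>\<omega>. birkhoff_sum f (Suc n) x \<omega> / (\<sigma> * sqrt (real n)))) t)
      \<longlonglongrightarrow> cdf std_normal_distribution t"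
    using quenched_clt[OF assms, of x] isCont_cdf_std_normal[of t]
    unfolding weak_conv_m_def weak_conv_def by blast
  ultimately show ?thesis by (simp only: cdf_std_normal)
qed

text \<open>The characteristic function is the Haar mean of the quenched ones, which converge boundedly.\<close>
lemma annealed_clt:
  fixes f \<psi> :: "'n torus \<Rightarrow> real"
  assumes f: "continuous_on UNIV f" and \<psi>: "continuous_on UNIV \<psi>" and eq: "\<And>x. f x = \<psi> x - P \<psi> x"
    and \<sigma>: "\<sigma> > 0" "asymptotic_variance \<psi> = \<sigma>\<^sup>2"
  shows "weak_conv_m (\<lambda>n. distr (torus_haar \<Otimes>\<^sub>M steps) borel
      (\<lambda>(x, \<omega>). birkhoff_sum f n x \<omega> / (\<sigma> * sqrt (real n)))) std_normal_distribution"
proof (rule levy_continuity)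
  interpret S: prob_space steps by (rule prob_space_steps)
  interpret pair_prob_space "torus_haar :: 'n torus measure" steps ..
  have [measurable]: "f \<in> borel_measurable borel" using f by (rule borel_measurable_continuous_onI)
  have [measurable]: "(\<lambda>z. birkhoff_sum f n (fst z) (snd z)) \<in> borel_measurable (torus_haar \<Otimes>\<^sub>M steps)" for n
    by (rule measurable_birkhoff_sum) measurable
  show "real_distribution (distr (torus_haar \<Otimes>\<^sub>M steps) borel
      (\<lambda>(x, \<omega>). birkhoff_sum f n x \<omega> / (\<sigma> * sqrt (real n))))" for n
    unfolding case_prod_unfold by (rule P.real_distribution_distr) measurable
  show "real_distribution std_normal_distribution" by (rule real_dist_normal_dist)
  fix t
  let ?s = "\<lambda>n. t / \<sigma> / sqrt (real n)"
  let ?u = "\<lambda>n. (twisted f (?s n) ^^ n) (\<lambda>_. 1)"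
  have lim: "(\<lambda>n. ?u n y) \<longlonglongrightarrow> of_real (exp (- t\<^sup>2 / 2))" for y
    using twisted_pow_tendsto[OF f \<psi> eq, of "t / \<sigma>" y] \<sigma> by (simp add: power_divide)
  have cu: "continuous_on UNIV (?u n)" for n by (intro continuous_twisted_pow f continuous_intros)
  have "char (distr (torus_haar \<Otimes>\<^sub>M steps) borel (\<lambda>(x, \<omega>). birkhoff_sum f n x \<omega> / (\<sigma> * sqrt (real n)))) t
      = (\<integral>x. ?u n x \<partial>torus_haar)" for n
  proof -
    have "char (distr (torus_haar \<Otimes>\<^sub>M steps) borel (\<lambda>(x, \<omega>). birkhoff_sum f n x \<omega> / (\<sigma> * sqrt (real n)))) t
        = (\<integral>z. iexp (?s n * birkhoff_sum f n (fst z) (snd z)) \<partial>(torus_haar \<Otimes>\<^sub>M steps))"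
      unfolding char_def case_prod_unfold by (subst integral_distr) auto
    also have "\<dots> = (\<integral>x. \<integral>\<omega>. iexp (?s n * birkhoff_sum f n x \<omega>) \<partial>steps \<partial>torus_haar)"
    proof -
      have "integrable (torus_haar \<Otimes>\<^sub>M steps) (\<lambda>z. iexp (?s n * birkhoff_sum f n (fst z) (snd z)))"
        by (rule P.integrable_const_bound[of _ 1]) auto
      from integral_fst'[OF this] show ?thesis by simp
    qed
    also have "\<dots> = (\<integral>x. ?u n x \<partial>torus_haar)"
      by (simp only: expectation_iexp_birkhoff_sum[OF f])
    finally show ?thesis .
  qed
  moreover have "(\<lambda>n. \<integral>x. ?u n x \<partial>torus_haar) \<longlonglongrightarrow> (\<integral>x. of_real (exp (- t\<^sup>2 / 2)) \<partial>(torus_haar :: 'n torus measure))"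
  proof (rule integral_dominated_convergence[where w = "\<lambda>_. 1"])
    show "?u n \<in> borel_measurable torus_haar" for n
      by (rule borel_measurable_integrable[OF integrable_torus_continuous[OF cu]])
    show "AE x in torus_haar. norm (?u n x) \<le> 1" for n
      by (intro AE_I2 norm_twisted_pow_le f continuous_intros) auto
  qed (use lim in auto)
  ultimately show "(\<lambda>n. char (distr (torus_haar \<Otimes>\<^sub>M steps) borel (\<lambda>(x, \<omega>). birkhoff_sum f n x \<omega> / (\<sigma> * sqrt (real n)))) t)
      \<longlonglongrightarrow> char std_normal_distribution t"
    by (simp add: char_std_normal_distribution torus_haar.prob_space[simplified])
qed

end

text \<open>The upper bound transfers the Diophantine condition to the Euclidean norm, because the condition
  becomes weaker when the norm is enlarged.\<close>
lemma is_norm_le_norm: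
  fixes N :: "real ^ 'n \<Rightarrow> real"
  assumes "is_norm N"
  obtains C where "C > 0" "\<And>x. N x \<le> C * norm x"
proof -
  have N0: "N 0 = 0" and scale: "\<And>c x. N (c *\<^sub>R x) = \<bar>c\<bar> * N x"
    and tri: "\<And>x y. N (x + y) \<le> N x + N y"
    using assms by (auto simp: is_norm_def)
  have nn: "N x \<ge> 0" for x
    using tri[of x "- 1 *\<^sub>R x"] scale[of "- 1" x] N0 by simp
  have sum_le: "N (\<Sum>i\<in>I. g i) \<le> (\<Sum>i\<in>I. N (g i))" if "finite I" for I and g :: "'n \<Rightarrow> real ^ 'n"
    using that by (induction I) (auto simp: N0 intro: order_trans[OF tri])
  define C where "C = 1 + (\<Sum>i\<in>UNIV. N (axis i 1))"
  have "N x \<le> C * norm x" for x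
  proof -
    have "N x = N (\<Sum>i\<in>UNIV. x $ i *\<^sub>R axis i 1)"
      by (simp add: basis_expansion flip: scalar_mult_eq_scaleR)
    also have "\<dots> \<le> (\<Sum>i\<in>UNIV. \<bar>x $ i\<bar> * N (axis i 1))"
      using sum_le[of UNIV "\<lambda>i. x $ i *\<^sub>R axis i 1"] by (simp add: scale)
    also have "\<dots> \<le> (\<Sum>i\<in>UNIV. norm x * N (axis i 1))"
      by (intro sum_mono mult_right_mono component_le_norm_cart nn)
    also have "\<dots> \<le> C * norm x" by (simp add: C_def algebra_simps flip: sum_distrib_left)
    finally show ?thesis .
  qed
  moreover have "C > 0" using sum_nonneg[of UNIV "\<lambda>i. N (axis i 1)"] nn by (simp add: C_def add_pos_nonneg)
  ultimately show thesis using that by blast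
qed

lemma mixing_DC_imp_exp_decay:
  fixes N :: "real ^ 'n \<Rightarrow> real" and \<mu> :: "'n::finite torus measure"
  assumes N: "is_norm N" and DC: "mixing_DC N \<gamma> \<tau> \<mu>" and pos: "\<gamma> > 0" "\<tau> > 0"
  obtains c where "c > 0" "\<And>k. k \<noteq> 0 \<Longrightarrow> cmod (fourier_coeff \<mu> k) \<le> exp (- (c / norm (real_vec k) powr \<tau>))"
proof -
  obtain C where C: "C > 0" "\<And>x. N x \<le> C * norm x" using is_norm_le_norm[OF N] by blast
  have Npos: "N x > 0" if "x \<noteq> 0" for x
  proof -
    have "N 0 \<le> N x + N (- 1 *\<^sub>R x)" "N (- 1 *\<^sub>R x) = \<bar>- 1\<bar> * N x" "N 0 = 0" "N x \<noteq> 0"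
      using N that unfolding is_norm_def by (metis add.right_inverse scaleR_minus1_left, metis+)
    then show ?thesis by simp
  qed
  show thesis
  proof (rule that)
    show "\<gamma> / C powr \<tau> > 0" using C pos by simp
    fix k :: "int ^ 'n" assume k: "k \<noteq> 0"
    have Nk: "N (real_vec k) > 0" by (rule Npos) (simp add: real_vec_eq_0_iff k)
    have "\<gamma> / C powr \<tau> / norm (real_vec k) powr \<tau> = \<gamma> / (C * norm (real_vec k)) powr \<tau>"
      using C by (simp add: powr_mult)
    also have "\<dots> \<le> \<gamma> / N (real_vec k) powr \<tau>"
      using C Nk pos by (intro divide_left_mono powr_mono2 mult_pos_pos) (auto simp: real_vec_eq_0_iff k)
    finally have 1: "\<gamma> / C powr \<tau> / norm (real_vec k) powr \<tau> \<le> \<gamma> / N (real_vec k) powr \<tau>" .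
    have "cmod (fourier_coeff \<mu> k) \<le> 1 + - (\<gamma> / N (real_vec k) powr \<tau>)"
      using DC k by (simp add: mixing_DC_def)
    also have "\<dots> \<le> exp (- (\<gamma> / N (real_vec k) powr \<tau>))" by (rule exp_ge_add_one_self)
    also have "\<dots> \<le> exp (- (\<gamma> / C powr \<tau> / norm (real_vec k) powr \<tau>))" using 1 by simp
    finally show "cmod (fourier_coeff \<mu> k) \<le> exp (- (\<gamma> / C powr \<tau> / norm (real_vec k) powr \<tau>))" .
  qed
qed

lemma holder_continuous_imp_continuous_on:
  fixes f :: "'a::metric_space \<Rightarrow> 'b::metric_space"
  assumes "holder_continuous \<alpha> f" and "\<alpha> > 0"
  shows "continuous_on S f"
proof -
  obtain C where C: "\<And>x y. dist (f x) (f y) \<le> C * dist x y powr \<alpha>"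
    using assms(1) by (auto simp: holder_continuous_def)
  have "isCont f x" for x
    unfolding isCont_def
  proof (rule metric_tendsto_imp_tendsto)
    show "\<forall>\<^sub>F y in at x. dist (f y) (f x) \<le> dist (C * dist y x powr \<alpha>) 0"
      using C by (auto intro!: always_eventually order_trans[OF C])
    have "((\<lambda>y. C * dist y x powr \<alpha>) \<longlongrightarrow> C * dist x x powr \<alpha>) (at x)"
      using assms(2) by (intro tendsto_mult tendsto_const tendsto_powr' tendsto_dist tendsto_ident_at) auto
    then show "((\<lambda>y. C * dist y x powr \<alpha>) \<longlongrightarrow> 0) (at x)" using assms(2) by simp
  qed
  then show ?thesis by (simp add: continuous_at_imp_continuous_on)
qed

theorem theorem1p3:
  fixes \<mu> :: "'n::finite torus measure"
    and N :: "real ^ 'n \<Rightarrow> real"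
    and \<gamma> \<tau> \<alpha> :: real
    and \<phi> :: "'n torus \<Rightarrow> real"
  assumes "prob_space \<mu>" and "sets \<mu> = sets borel"
    and "is_norm N"
    and "\<gamma> > 0" and "\<tau> > 0" and "mixing_DC N \<gamma> \<tau> \<mu>"
    and "0 < \<alpha>" and "\<alpha> \<le> 1" and "\<alpha> > \<tau>"
    and "holder_continuous \<alpha> \<phi>" and "\<phi> \<noteq> (\<lambda>_. 0)"
    and "(\<integral>\<theta>. \<phi> \<theta> \<partial>torus_haar) = 0"
  shows "\<exists>\<sigma>>0.
    weak_conv_m
      (\<lambda>n. distr (torus_haar \<Otimes>\<^sub>M (\<Pi>\<^sub>M i\<in>(UNIV::nat set). \<mu>)) borel
             (\<lambda>(\<theta>, \<omega>). birkhoff_sum \<phi> n \<theta> \<omega> / (\<sigma> * sqrt (real n))))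
      std_normal_distribution \<and>
    (AE \<theta> in torus_haar. \<forall>t::real.
      (\<lambda>n. measure (\<Pi>\<^sub>M i\<in>(UNIV::nat set). \<mu>)
             {\<omega>. (\<Sum>j\<le>n. \<phi> (walk \<theta> \<omega> j)) / (\<sigma> * sqrt (real n)) \<le> t})
      \<longlonglongrightarrow> (LINT x:{..t}|lborel. exp (- x\<^sup>2 / 2) / sqrt (2 * pi)))"
proof -
  obtain c where c: "c > 0" "\<And>k. k \<noteq> 0 \<Longrightarrow> cmod (fourier_coeff \<mu> k) \<le> exp (- (c / norm (real_vec k) powr \<tau>))"
    using mixing_DC_imp_exp_decay[OF assms(3,6,4,5)] by blast
  interpret diophantine_walk \<mu> c \<tau>
    by (intro diophantine_walk.intro torus_walk.intro torus_walk_axioms.intro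
        diophantine_walk_axioms.intro assms(1,2,5) c)
  have \<phi>: "continuous_on UNIV \<phi>"
    by (rule holder_continuous_imp_continuous_on[OF assms(10,7)])
  obtain \<psi> where \<psi>: "continuous_on UNIV \<psi>" and eq: "\<And>x. \<phi> x = \<psi> x - P \<psi> x"
    using poisson_equation[OF assms(10,9,8) \<phi> assms(12)] by blast
  obtain x where "\<phi> x \<noteq> 0" using assms(11) by auto
  then have V: "asymptotic_variance \<psi> > 0"
    using asymptotic_variance_pos[OF \<psi>, of x] eq[of x] by simp
  define \<sigma> where "\<sigma> = sqrt (asymptotic_variance \<psi>)"
  have \<sigma>: "\<sigma> > 0" "asymptotic_variance \<psi> = \<sigma>\<^sup>2" using V by (simp_all add: \<sigma>_def)
  have "birkhoff_sum \<phi> (Suc n) \<theta> \<omega> = (\<Sum>j\<le>n. \<phi> (walk \<theta> \<omega> j))" for n \<theta> \<omega>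
    by (simp add: birkhoff_sum_def lessThan_Suc_atMost)
  then show ?thesis
    using \<sigma>(1) annealed_clt[OF \<phi> \<psi> eq \<sigma>] quenched_clt_cdf[OF \<phi> \<psi> eq \<sigma>] by auto
qed

end
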